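(* Let $d\ge 1$, let $\mathbb A=\{0,1,\dots,d\}$ and fix $t>0$. For $\epsilon>0$ and $n\in\mathbb N=\{1,2,\dots\}$ let $$f^\star(X;\epsilon)=\tfrac12\bigl(X-\epsilon X^{\star(-1)}\bigr),\qquad f^{-1}(X;\epsilon)=X+\bigl(X^{\star2}+\epsilon\nu\bigr)^{\star(1/2)},$$ and let $$\widehat{\mathrm{id}}_{\epsilon}:=f^{-1}\bigl(\pi_{\mathbb S_{\le n}}\circ f^\star(\mathrm{id};\epsilon);\epsilon\bigr),\qquad R_\epsilon:=\mathrm{id}-\widehat{\mathrm{id}}_{\epsilon}$$ be the associated integrator of strong order $n/2$ and its remainder. Let $\|\cdot\|$ denote the norm with respect to the graded class subspace $\mathbb S=\mathbb S_{n+1}$. Then: 1. For every $\epsilon>0$ the integrator generated by $f^\star(\mathrm{id};\epsilon)$ is efficient, i.e. for every $n\in\mathbb N$ and every $\mathsf V$, $$\|(\mathrm{id}-E)\circ R_\epsilon\|^2\le\|(\mathrm{id}-E)\circ\mathrm{id}\|^2 .$$ 2. For every $n\in\mathbb N$ and every $\mathsf V$, the mean-square excess $$\epsilon\longmapsto\|(\mathrm{id}-E)\circ\mathrm{id}\|^2-\|(\mathrm{id}-E)\circ R_\epsilon\|^2,\qquad \epsilon\in(0,\infty),$$ is positive and is maximized at $\epsilon=1$, that is, for the sinhlog endomorphism $f^\star(\mathrm{id};1)=\tfrac12(\mathrm{id}-S)$. Thus the integrator based on the sinhlog endomorphism is optimally efficient within the class $\{f^\star(\mathrm{id};\epsilo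n):\epsilon>0\}$.
   Context: **Words and shuffle algebra.** $\mathbb A^*$ is the free monoid of words on $\mathbb A$, $\mathbf 1$ the empty word, $|w|$ the length of $w$. $\mathbb R\langle\mathbb A\rangle$ is the real vector space with basis $\mathbb A^*$, equipped with the (commutative) shuffle product, written $u\sqcup\!\sqcup v$ (the sum of all shuffles of $u$ and $v$), and the deconcatenation coproduct $\Delta(w)=\sum_{uv=w}u\otimes v$. **Convolution algebra.** $\mathbb H$ is the space of linear endomorphisms of $\mathbb R\langle\mathbb A\rangle$ with convolution product $(X\star Y)(w)=\sum_{uv=w}X(u)\sqcup\!\sqcup Y(v)$. Its unit is $\nu$, with $\nu(\mathbf 1)=\mathbf 1$ and $\nu(w)=0$ for nonempty $w$. The identity map is $\mathrm{id}$ and the antipode is $S(a_1\cdots a_n)=(-1)^na_n\cdots a_1$; $S=\mathrm{id}^{\star(-1)}$, the convolution inverse of $\mathrm{id}$. Powers $X^{\star k}$ and inverses $X^{\star(-1)}$ are with respect to $\star$; $\circ$ is composition of maps. If $Z\in\mathbb H$ satisfies $Z(\mathbf 1)=c\,\mathbf 1$ with $c>0$, then $Z^{\star(1/2)}$ is the convolution square root taking the value $c^{1/2}\mathbf 1$ on $\mathbf 1$, given by the binomial series $c^{1/2}\sum_{k\ge0}\binom{1/2}{k}\bigl(c^{-1}Z-\nu\bigr)^{\star k}$ (a finite sum on every word). For $X=\pi_{\mathbb S_{\le n}}\circ f^\star(\mathrm{id};\epsilon)$ one has $X(\mathbf 1)=\tfrac12(1-\epsilon)\mathbf 1$, so $(X^{\star2}+\epsilon\nu)(\mathbf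 1)=\tfrac14(1+\epsilon)^2\mathbf 1$. **Expectation.** Let $\mathbb D^*\subset\mathbb A^*$ be the set of words that are concatenations of the blocks $0,11,22,\dots,dd$ (including $\mathbf 1$). The linear map $\bar E:\mathbb R\langle\mathbb A\rangle\to\mathbb R$ is given by $\bar E(w)=t^{\mathrm n(w)}/\bigl(2^{\mathrm d(w)}\,\mathrm n(w)!\bigr)$ for $w\in\mathbb D^*$ and $\bar E(w)=0$ otherwise, where $\mathrm d(w)$ is the number of nonzero pair-blocks $ii$ in $w$, $\mathrm z(w)$ is the number of letters $0$ in $w$, and $\mathrm n(w)=\mathrm z(w)+\mathrm d(w)$. (Thus $\bar E(w)$ is the expectation of the multiple Stratonovich integral over $[0,t]$ indexed by $w$, where letter $0$ stands for time and letters $1,\dots,d$ for independent Wiener processes.) The expectation endomorphism $E\in\mathbb H$ is $E(w)=\bar E(w)\,\mathbf 1$. **Grading.** $\mathbb S_k$ is the span of the words of length $k$, and $\mathbb S_{\le n}=\bigoplus_{k\le n}\mathbb S_k$; $\pi_{\mathbb S}$ is the canonical projection onto $\mathbb S$ (killing words of other lengths). **Inner product.** $\mathsf V=(\mathsf V_{u,v})_{u,v\in\mathbb A^*}$ is a real symmetric positive definite matrix indexed by words ($\mathsf V_{u,v}$ is the inner product of vectors $\mathsf V_u,\mathsf V_v$ standing for the vector fields indexed by $u$ and $v$). For $X,Y\in\mathbb H$, $$\langle X,Y\rangle_{\mathbb H}=\sum_{u,v\in\mathbb A^*}\bar E\bigl(X(u)\sqcup\!\sqcup Y(v)\bigr)\mathsf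 V_{u,v}.$$ For a given $\mathbb S$, $\langle X,Y\rangle:=\langle X\circ\pi_{\mathbb S},Y\circ\pi_{\mathbb S}\rangle_{\mathbb H}$ and $\|X\|:=\langle X,X\rangle^{1/2}$. **Interpretation.** $(\mathrm{id}-E)\circ R$ restricted to $\mathbb S_{n+1}$ is the leading-order local error of an integrator with remainder $R$ once the expectations of the leading-order remainder terms are added to the integrator; the stochastic Taylor integrator has $R=\mathrm{id}$ on $\mathbb S_{n+1}$. *)

theory Defs
  imports "HOL-Library.Poly_Mapping" "HOL-Analysis.Infinite_Sum"
begin

section \<open>Words and the shuffle algebra\<close>

text \<open>
  The alphabet \<open>{0, 1, \<dots>, d}\<close> is the type \<open>'d option\<close>, where \<open>'d\<close> is a finite type with
  \<open>d = CARD('d)\<close> elements: \<open>None\<close> is the letter \<open>0\<close> (time) and \<open>Some i\<close> are the letters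
  \<open>1, \<dots>, d\<close> (Wiener processes). Types are nonempty, so \<open>d \<ge> 1\<close>.
\<close>

type_synonym 'd word = "'d option list"

type_synonym 'd walg = "'d word \<Rightarrow>\<^sub>0 real"

instantiation poly_mapping :: (type, real_vector) real_vector
begin

definition scaleR_poly_mapping :: "real \<Rightarrow> ('a \<Rightarrow>\<^sub>0 'b) \<Rightarrow> ('a \<Rightarrow>\<^sub>0 'b)" where
  "scaleR_poly_mapping r p = Poly_Mapping.map (\<lambda>x. r *\<^sub>R x) p"

lemma lookup_scaleR:
  "Poly_Mapping.lookup (r *\<^sub>R p) k = r *\<^sub>R Poly_Mapping.lookup (p :: 'a \<Rightarrow>\<^sub>0 'b) k"
  by (simp add: scaleR_poly_mapping_def map.rep_eq when_def)

instance
  by standard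
    (auto intro!: poly_mapping_eqI simp: lookup_scaleR lookup_add scaleR_add_right scaleR_add_left)

end

definition of_word :: "'a list \<Rightarrow> ('a list \<Rightarrow>\<^sub>0 real)" where
  "of_word w = Poly_Mapping.single w 1"

text \<open>The linear extension of a function given on the basis of words.\<close>

definition lin_ext :: "('a list \<Rightarrow> 'b::real_vector) \<Rightarrow> ('a list \<Rightarrow>\<^sub>0 real) \<Rightarrow> 'b" where
  "lin_ext g p = (\<Sum>w\<in>Poly_Mapping.keys p. Poly_Mapping.lookup p w *\<^sub>R g w)"

text \<open>
  All shuffles of two words, listed with multiplicity (the library's \<open>shuffles\<close> is a set and
  forgets multiplicities).
\<close>

fun shuffle_list :: "'a list \<Rightarrow> 'a list \<Rightarrow> 'a list list" where
  "shuffle_list [] v = [v]"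
| "shuffle_list u [] = [u]"
| "shuffle_list (a # u) (b # v) =
     map ((#) a) (shuffle_list u (b # v)) @ map ((#) b) (shuffle_list (a # u) v)"

definition shuffle :: "('a list \<Rightarrow>\<^sub>0 real) \<Rightarrow> ('a list \<Rightarrow>\<^sub>0 real) \<Rightarrow> ('a list \<Rightarrow>\<^sub>0 real)" where
  "shuffle p q =
     lin_ext (\<lambda>u. lin_ext (\<lambda>v. sum_list (map of_word (shuffle_list u v))) q) p"


section \<open>The convolution algebra\<close>

text \<open>
  Elements of the convolution algebra are the \<open>linear\<close> maps among the functions of type \<open>'d endo\<close>.
\<close>

type_synonym 'd endo = "'d walg \<Rightarrow> 'd walg"

definition conv :: "'d endo \<Rightarrow> 'd endo \<Rightarrow> 'd endo" (infixl \<open>\<star>\<close> 70) where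
  "X \<star> Y = lin_ext (\<lambda>w. \<Sum>(u, v) \<in> {(u, v). u @ v = w}. shuffle (X (of_word u)) (Y (of_word v)))"

definition conv_unit :: "'d endo" (\<open>\<nu>\<close>) where
  "\<nu> = lin_ext (\<lambda>w. if w = [] then of_word [] else 0)"

fun conv_pow :: "'d endo \<Rightarrow> nat \<Rightarrow> 'd endo" where
  "conv_pow X 0 = \<nu>"
| "conv_pow X (Suc k) = X \<star> conv_pow X k"

definition conv_inv :: "'d endo \<Rightarrow> 'd endo" where
  "conv_inv X = (THE Y. linear Y \<and> X \<star> Y = \<nu> \<and> Y \<star> X = \<nu>)"

text \<open>
  Binomial series for the square root, meaningful if \<open>Z\<close> maps the empty word to \<open>c\<close> times itself
  with \<open>c > 0\<close>. On every word only finitely many terms are nonzero, as \<open>Z / c - \<nu>\<close> kills the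
  empty word.
\<close>

definition conv_sqrt :: "'d endo \<Rightarrow> 'd endo" where
  "conv_sqrt Z =
     (let c = Poly_Mapping.lookup (Z (of_word [])) [];
          D = (\<lambda>p. inverse c *\<^sub>R Z p - \<nu> p)
      in lin_ext (\<lambda>w. sqrt c *\<^sub>R
           Sum_any (\<lambda>k. ((1/2 :: real) gchoose k) *\<^sub>R conv_pow D k (of_word w))))"

definition antipode :: "'d endo" where
  "antipode = lin_ext (\<lambda>w. (- 1) ^ length w *\<^sub>R of_word (rev w))"

text \<open>
  Projection onto the span of the words whose length lies in \<open>K\<close>: \<open>K = {..n}\<close> and
  \<open>K = {n + 1}\<close> give the projections onto the words of length at most \<open>n\<close> and exactly \<open>n + 1\<close>.
\<close>

definition proj :: "nat set \<Rightarrow> 'd endo" where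
  "proj K = lin_ext (\<lambda>w. if length w \<in> K then of_word w else 0)"


section \<open>Expectation and inner product\<close>

definition blocks :: "'d word set" where
  "blocks = insert [None] (range (\<lambda>i. [Some i, Some i]))"

definition dwords :: "'d word set" where
  "dwords = {concat bs | bs. set bs \<subseteq> blocks}"

definition num_zero :: "'d word \<Rightarrow> nat" where
  "num_zero w = length (filter (\<lambda>a. a = None) w)"

text \<open>On \<open>dwords\<close> the nonzero letters come in pair-blocks \<open>[Some i, Some i]\<close>.\<close>

definition num_pair :: "'d word \<Rightarrow> nat" where
  "num_pair w = length (filter (\<lambda>a. a \<noteq> None) w) div 2"

definition num_block :: "'d word \<Rightarrow> nat" where
  "num_block w = num_zero w + num_pair w"

definition expect :: "real \<Rightarrow> 'd walg \<Rightarrow> real" where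
  "expect t = lin_ext (\<lambda>w. if w \<in> dwords
     then t ^ num_block w / (2 ^ num_pair w * fact (num_block w)) else 0)"

definition expect_endo :: "real \<Rightarrow> 'd endo" where
  "expect_endo t = lin_ext (\<lambda>w. expect t (of_word w) *\<^sub>R of_word [])"

text \<open>Symmetric positive definite infinite matrices, tested on finitely supported vectors.\<close>

definition sym_pos_def :: "('i \<Rightarrow> 'i \<Rightarrow> real) \<Rightarrow> bool" where
  "sym_pos_def V \<longleftrightarrow>
     (\<forall>u v. V u v = V v u) \<and>
     (\<forall>x :: 'i \<Rightarrow>\<^sub>0 real. x \<noteq> 0 \<longrightarrow>
        0 < (\<Sum>u\<in>Poly_Mapping.keys x. \<Sum>v\<in>Poly_Mapping.keys x.
               Poly_Mapping.lookup x u * Poly_Mapping.lookup x v * V u v))"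

definition inner_endo ::
  "real \<Rightarrow> ('d word \<Rightarrow> 'd word \<Rightarrow> real) \<Rightarrow> 'd endo \<Rightarrow> 'd endo \<Rightarrow> real" where
  "inner_endo t V X Y =
     (\<Sum>\<^sub>\<infinity>(u, v)\<in>UNIV. expect t (shuffle (X (of_word u)) (Y (of_word v))) * V u v)"

definition graded_inner ::
  "real \<Rightarrow> ('d word \<Rightarrow> 'd word \<Rightarrow> real) \<Rightarrow> nat set \<Rightarrow> 'd endo \<Rightarrow> 'd endo \<Rightarrow> real" where
  "graded_inner t V K X Y = inner_endo t V (X \<circ> proj K) (Y \<circ> proj K)"

definition graded_norm ::
  "real \<Rightarrow> ('d word \<Rightarrow> 'd word \<Rightarrow> real) \<Rightarrow> nat set \<Rightarrow> 'd endo \<Rightarrow> real" where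
  "graded_norm t V K X = sqrt (graded_inner t V K X X)"


section \<open>The class of integrators\<close>

definition f_star :: "'d endo \<Rightarrow> real \<Rightarrow> 'd endo" where
  "f_star X \<epsilon> = (\<lambda>p. (1/2) *\<^sub>R (X p - \<epsilon> *\<^sub>R conv_inv X p))"

definition f_inv :: "'d endo \<Rightarrow> real \<Rightarrow> 'd endo" where
  "f_inv X \<epsilon> = (\<lambda>p. X p + conv_sqrt (\<lambda>q. conv_pow X 2 q + \<epsilon> *\<^sub>R \<nu> q) p)"

definition integrator :: "nat \<Rightarrow> real \<Rightarrow> 'd endo" where
  "integrator n \<epsilon> = f_inv (proj {..n} \<circ> f_star id \<epsilon>) \<epsilon>"

definition remainder :: "nat \<Rightarrow> real \<Rightarrow> 'd endo" where
  "remainder n \<epsilon> = (\<lambda>p. id p - integrator n \<epsilon> p)"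

definition id_minus_E :: "real \<Rightarrow> 'd endo" where
  "id_minus_E t = (\<lambda>p. id p - expect_endo t p)"

definition ms_excess ::
  "real \<Rightarrow> ('d word \<Rightarrow> 'd word \<Rightarrow> real) \<Rightarrow> nat \<Rightarrow> real \<Rightarrow> real" where
  "ms_excess t V n \<epsilon> =
     (graded_norm t V {n + 1} (id_minus_E t \<circ> id))\<^sup>2
     - (graded_norm t V {n + 1} (id_minus_E t \<circ> remainder n \<epsilon>))\<^sup>2"

end

theory Submission
  imports Defs
begin

text \<open>
  Since \<open>f\<^sup>-\<^sup>1\<close> inverts \<open>f\<^sup>\<star>\<close> and the truncation only changes words of length greater than \<open>n\<close>, a
  comparison of convolution squares shows that the remainder is \<open>(id - \<epsilon> S) / (1 + \<epsilon>)\<close> on words of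
  length \<open>n + 1\<close>. The antipode \<open>S\<close> reverses words up to sign, so it preserves covariances of words
  of equal length, and the mean-square excess equals \<open>2 \<epsilon> / (1 + \<epsilon>)\<^sup>2\<close> times a constant, which is half
  the squared norm of \<open>(id - E) (id + S)\<close>. That the covariance is positive semidefinite is proved
  without stochastic integrals: the expectation is \<open>exp (t L)\<close> followed by the counit, where \<open>L\<close> is a
  second order differential operator built from the derivations that remove the first letter of
  a word, and the variance is the time integral of second moments of elements of lower degree.
\<close>

section \<open>Linear extension\<close>

text \<open>Writing \<open>x\<close> for \<open>id\<close> and \<open>1/x\<close> for the antipode,
  the scalar identity ((x + e/x)/2)^2 = ((x - e/x)/2)^2 + e shows that the exact root is (id + e
  S)/2. At the first truncated length a convolution square sees the new value only through the
  constant coefficients, which are (1 - e)/2 for f-star and (1 + e)/2 for the root. Deleting the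
  value F of f-star therefore lowers the root by (1 - e)/(1 + e) F, and the remainder is F plus this
  defect, that is 2/(1 + e) F. The remaining obstacle is that \<open>V\<close> is arbitrary: the
  squared norm is the sum of the entrywise product of a covariance matrix with \<open>V\<close>. For
  semidefinite covariance and definite \<open>V\<close> this sum is positive as soon as one diagonal
  covariance is. So strictness needs only one word whose image under id + S has positive variance,
  and the word 0...0i serves.\<close>

lemma lin_ext_superset:
  assumes "finite A" "Poly_Mapping.keys p \<subseteq> A"
  shows "lin_ext g p = (\<Sum>w\<in>A. Poly_Mapping.lookup p w *\<^sub>R g w)"
  unfolding lin_ext_def
  by (rule sum.mono_neutral_left) (use assms in \<open>auto simp: in_keys_iff\<close>)

lemma linear_lin_ext [simp]: "linear (lin_ext g)"
proof (rule linearI)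
  fix p q :: "'a list \<Rightarrow>\<^sub>0 real" and r :: real
  let ?A = "Poly_Mapping.keys p \<union> Poly_Mapping.keys q \<union> Poly_Mapping.keys (p + q)"
  show "lin_ext g (p + q) = lin_ext g p + lin_ext g q"
    by (subst (1 2 3) lin_ext_superset[where A = ?A])
      (auto simp: lookup_add scaleR_add_left sum.distrib)
  let ?B = "Poly_Mapping.keys p \<union> Poly_Mapping.keys (r *\<^sub>R p)"
  show "lin_ext g (r *\<^sub>R p) = r *\<^sub>R lin_ext g p"
    by (subst (1 2) lin_ext_superset[where A = ?B])
      (auto simp: lookup_scaleR scaleR_sum_right)
qed

lemma lin_ext_of_word [simp]: "lin_ext g (of_word w) = g w"
  by (simp add: lin_ext_def of_word_def)

lemma lookup_of_word: "Poly_Mapping.lookup (of_word u) v = (if u = v then 1 else 0)"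
  by (simp add: of_word_def lookup_single when_def)

lemma walg_expand:
  fixes p :: "'a list \<Rightarrow>\<^sub>0 real"
  shows "p = (\<Sum>w\<in>Poly_Mapping.keys p. Poly_Mapping.lookup p w *\<^sub>R of_word w)"
proof (rule poly_mapping_eqI)
  fix k
  show "Poly_Mapping.lookup p k = Poly_Mapping.lookup
      (\<Sum>w\<in>Poly_Mapping.keys p. Poly_Mapping.lookup p w *\<^sub>R of_word w) k"
    by (auto simp: lookup_sum lookup_scaleR lookup_of_word in_keys_iff
        if_distrib[of "\<lambda>x. _ * x"] cong: if_cong)
qed

lemma linear_expand:
  assumes "linear f"
  shows "f p = (\<Sum>w\<in>Poly_Mapping.keys p. Poly_Mapping.lookup p w *\<^sub>R f (of_word w))"
  by (subst walg_expand[of p]) (simp add: linear_sum[OF assms] linear_scale[OF assms] o_def)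

lemma linear_eqI:
  assumes "linear f" "linear g" "\<And>w. f (of_word w) = g (of_word w)"
  shows "f p = g p"
  by (subst (1 2) linear_expand) (use assms in simp_all)

lemma lookup_linear: "linear (\<lambda>p :: 'a \<Rightarrow>\<^sub>0 real. Poly_Mapping.lookup p w)"
  by (rule linearI) (simp_all add: lookup_add lookup_scaleR)


section \<open>The shuffle product\<close>

lemma shuffle_linear_right: "linear (shuffle p)"
  unfolding shuffle_def lin_ext_def[of _ p]
  by (intro linear_compose_sum ballI linear_compose_scale_right) simp

lemma shuffle_linear_left: "linear (\<lambda>p. shuffle p q)"
  unfolding shuffle_def by simp

lemmas shuffle_simps =
  linear_add[OF shuffle_linear_left] linear_add[OF shuffle_linear_right]
  linear_diff[OF shuffle_linear_left] linear_diff[OF shuffle_linear_right]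
  linear_scale[OF shuffle_linear_left] linear_scale[OF shuffle_linear_right]
  linear_sum[OF shuffle_linear_left] linear_sum[OF shuffle_linear_right]
  linear_0[OF shuffle_linear_left] linear_0[OF shuffle_linear_right]
  linear_neg[OF shuffle_linear_left] linear_neg[OF shuffle_linear_right]

lemma shuffle_of_word:
  "shuffle (of_word u) (of_word v) = sum_list (map of_word (shuffle_list u v))"
  by (simp add: shuffle_def)

lemma shuffle_list_Nil2 [simp]: "shuffle_list u [] = [u]"
  by (cases u) simp_all

lemma shuffle_one_left [simp]: "shuffle (of_word []) p = p"
  by (rule linear_eqI[OF shuffle_linear_right linear_id[unfolded id_def]])
    (simp add: shuffle_of_word)

lemma shuffle_one_right [simp]: "shuffle p (of_word []) = p"
  by (rule linear_eqI[OF shuffle_linear_left linear_id[unfolded id_def]])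
    (simp add: shuffle_of_word)

section \<open>Left derivations of the shuffle algebra\<close>

definition left_deriv :: "'a \<Rightarrow> ('a list \<Rightarrow>\<^sub>0 real) \<Rightarrow> ('a list \<Rightarrow>\<^sub>0 real)" where
  "left_deriv a =
     lin_ext (\<lambda>w. case w of [] \<Rightarrow> 0 | b # v \<Rightarrow> if a = b then of_word v else 0)"

lemma linear_left_deriv: "linear (left_deriv a)"
  by (simp add: left_deriv_def)

lemmas left_deriv_simps =
  linear_add[OF linear_left_deriv] linear_diff[OF linear_left_deriv]
  linear_scale[OF linear_left_deriv] linear_sum[OF linear_left_deriv]
  linear_0[OF linear_left_deriv] linear_neg[OF linear_left_deriv]

lemma left_deriv_Nil [simp]: "left_deriv a (of_word []) = 0"
  and left_deriv_Cons [simp]: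
    "left_deriv a (of_word (b # v)) = (if a = b then of_word v else 0)"
  by (simp_all add: left_deriv_def)

lemma lookup_left_deriv: "Poly_Mapping.lookup (left_deriv a p) w = Poly_Mapping.lookup p (a # w)"
proof (rule linear_eqI[where p = p])
  show "linear (\<lambda>p. Poly_Mapping.lookup (left_deriv a p) w)"
    using linear_compose[OF linear_left_deriv lookup_linear] by (simp add: o_def)
  show "linear (\<lambda>p :: 'a list \<Rightarrow>\<^sub>0 real. Poly_Mapping.lookup p (a # w))"
    by (rule lookup_linear)
  show "Poly_Mapping.lookup (left_deriv a (of_word v)) w = Poly_Mapping.lookup (of_word v) (a # w)"
    for v by (cases v) (auto simp: lookup_of_word)
qed

text \<open>
  An element is determined by its constant coefficient and its left derivatives. Together with
  the Leibniz rule this reduces identities between shuffles to inductions on the length.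
\<close>

lemma walg_eqI:
  fixes p q :: "'a list \<Rightarrow>\<^sub>0 real"
  assumes "Poly_Mapping.lookup p [] = Poly_Mapping.lookup q []"
    and "\<And>a. left_deriv a p = left_deriv a q"
  shows "p = q"
proof (rule poly_mapping_eqI)
  fix w show "Poly_Mapping.lookup p w = Poly_Mapping.lookup q w"
    using assms by (cases w) (auto simp flip: lookup_left_deriv)
qed

lemma left_deriv_sum_list_Cons:
  "left_deriv c (sum_list (map (\<lambda>x. of_word (a # x)) L)) =
     (if c = a then sum_list (map of_word L) else 0)"
  by (induction L) (simp_all add: left_deriv_simps)

text \<open>The first letter of a shuffle comes from one of the two factors; these are the two
  branches of the recursion of \<open>shuffle_list\<close>.\<close>

lemma left_deriv_shuffle_words:
  "left_deriv c (shuffle (of_word u) (of_word v)) =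
     shuffle (left_deriv c (of_word u)) (of_word v) + shuffle (of_word u) (left_deriv c (of_word v))"
  by (cases u; cases v)
    (auto simp: shuffle_of_word left_deriv_simps left_deriv_sum_list_Cons o_def shuffle_simps)

lemma left_deriv_shuffle:
  "left_deriv c (shuffle p q) = shuffle (left_deriv c p) q + shuffle p (left_deriv c q)"
proof (rule linear_eqI[where p = p])
  show "linear (\<lambda>p. left_deriv c (shuffle p q))"
    "linear (\<lambda>p. shuffle (left_deriv c p) q + shuffle p (left_deriv c q))"
    by (rule linearI; simp add: shuffle_simps left_deriv_simps scaleR_add_right)+
  fix u
  show "left_deriv c (shuffle (of_word u) q)
      = shuffle (left_deriv c (of_word u)) q + shuffle (of_word u) (left_deriv c q)"
    by (rule linear_eqI[where p = q]; (rule linearI)?)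
      (simp_all add: shuffle_simps left_deriv_simps scaleR_add_right left_deriv_shuffle_words)
qed

text \<open>The counit is a character, because the empty word arises only as the shuffle of two
  empty words.\<close>

lemma lookup_Nil_shuffle:
  "Poly_Mapping.lookup (shuffle p q) [] = Poly_Mapping.lookup p [] * Poly_Mapping.lookup q []"
proof (rule linear_eqI[where p = p])
  show "linear (\<lambda>p. Poly_Mapping.lookup (shuffle p q) [])"
    "linear (\<lambda>p. Poly_Mapping.lookup p [] * Poly_Mapping.lookup q [])"
    by (rule linearI; simp add: shuffle_simps lookup_add lookup_scaleR algebra_simps)+
  have *: "Poly_Mapping.lookup (sum_list (map (\<lambda>x. of_word (a # x)) L)) [] = 0" for a :: 'a and L
    by (induction L) (simp_all add: lookup_add lookup_of_word)
  fix u
  show "Poly_Mapping.lookup (shuffle (of_word u) q) []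
      = Poly_Mapping.lookup (of_word u) [] * Poly_Mapping.lookup q []"
  proof (rule linear_eqI[where p = q])
    show "linear (\<lambda>q. Poly_Mapping.lookup (shuffle (of_word u) q) [])"
      "linear (\<lambda>q. Poly_Mapping.lookup (of_word u) [] * Poly_Mapping.lookup q [])"
      by (rule linearI; simp add: shuffle_simps lookup_add lookup_scaleR algebra_simps)+
    show "Poly_Mapping.lookup (shuffle (of_word u) (of_word v)) []
        = Poly_Mapping.lookup (of_word u) [] * Poly_Mapping.lookup (of_word v) []" for v
      by (cases u; cases v) (auto simp: shuffle_of_word lookup_of_word lookup_add o_def *)
  qed
qed

lemma shuffle_commute_words:
  "shuffle (of_word u) (of_word v) = shuffle (of_word v) (of_word u)"
proof (induction "length u + length v" arbitrary: u v rule: less_induct)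
  case less
  show ?case
  proof (rule walg_eqI)
    fix a
    have "shuffle (left_deriv a (of_word u)) (of_word v)
        = shuffle (of_word v) (left_deriv a (of_word u))"
      using less by (cases u) (auto simp: shuffle_simps)
    moreover have "shuffle (of_word u) (left_deriv a (of_word v))
        = shuffle (left_deriv a (of_word v)) (of_word u)"
      using less by (cases v) (auto simp: shuffle_simps)
    ultimately show "left_deriv a (shuffle (of_word u) (of_word v))
        = left_deriv a (shuffle (of_word v) (of_word u))"
      by (simp add: left_deriv_shuffle)
  qed (simp add: lookup_Nil_shuffle)
qed

lemma shuffle_commute: "shuffle p q = shuffle q p"
proof (rule linear_eqI[where p = p, OF shuffle_linear_left shuffle_linear_right])
  show "shuffle (of_word u) q = shuffle q (of_word u)" for u
    by (rule linear_eqI[where p = q, OF shuffle_linear_right shuffle_linear_left])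
      (rule shuffle_commute_words)
qed

lemma shuffle_assoc_words:
  "shuffle (shuffle (of_word u) (of_word v)) (of_word w)
     = shuffle (of_word u) (shuffle (of_word v) (of_word w))"
proof (induction "length u + length v + length w" arbitrary: u v w rule: less_induct)
  case less
  show ?case
  proof (rule walg_eqI)
    fix a
    have "shuffle (shuffle (left_deriv a (of_word u)) (of_word v)) (of_word w)
        = shuffle (left_deriv a (of_word u)) (shuffle (of_word v) (of_word w))"
      using less by (cases u) (auto simp: shuffle_simps)
    moreover have "shuffle (shuffle (of_word u) (left_deriv a (of_word v))) (of_word w)
        = shuffle (of_word u) (shuffle (left_deriv a (of_word v)) (of_word w))"
      using less by (cases v) (auto simp: shuffle_simps)
    moreover have "shuffle (shuffle (of_word u) (of_word v)) (left_deriv a (of_word w))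
        = shuffle (of_word u) (shuffle (of_word v) (left_deriv a (of_word w)))"
      using less by (cases w) (auto simp: shuffle_simps)
    ultimately show "left_deriv a (shuffle (shuffle (of_word u) (of_word v)) (of_word w))
        = left_deriv a (shuffle (of_word u) (shuffle (of_word v) (of_word w)))"
      by (simp add: left_deriv_shuffle shuffle_simps)
  qed (simp add: lookup_Nil_shuffle)
qed

lemma shuffle_assoc: "shuffle (shuffle p q) r = shuffle p (shuffle q r)"
proof (rule linear_eqI[where p = p])
  show "linear (\<lambda>p. shuffle (shuffle p q) r)" "linear (\<lambda>p. shuffle p (shuffle q r))"
    by (rule linearI; simp add: shuffle_simps)+
  fix u
  show "shuffle (shuffle (of_word u) q) r = shuffle (of_word u) (shuffle q r)"
  proof (rule linear_eqI[where p = q])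
    show "linear (\<lambda>q. shuffle (shuffle (of_word u) q) r)"
      "linear (\<lambda>q. shuffle (of_word u) (shuffle q r))"
      by (rule linearI; simp add: shuffle_simps)+
    fix v
    show "shuffle (shuffle (of_word u) (of_word v)) r = shuffle (of_word u) (shuffle (of_word v) r)"
      by (rule linear_eqI[where p = r]; (rule linearI)?)
        (simp_all add: shuffle_simps shuffle_assoc_words)
  qed
qed

section \<open>The expectation\<close>

lemma Nil_dwords [simp]: "[] \<in> dwords"
  unfolding dwords_def by (auto intro!: exI[of _ "[]"])

lemma block_append_dwords: "b \<in> blocks \<Longrightarrow> w \<in> dwords \<Longrightarrow> b @ w \<in> dwords"
  unfolding dwords_def by clarsimp (metis concat.simps(2) insert_subset list.simps(15))

text \<open>The first letter of a nonempty word determines its first block, so membership can be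
  decided from the left, the side on which the left derivations act.\<close>

lemma dwords_iff:
  "w \<in> dwords \<longleftrightarrow>
     w = [] \<or> (\<exists>v\<in>dwords. w = None # v \<or> (\<exists>i. w = Some i # Some i # v))"
proof
  assume "w \<in> dwords"
  then obtain bs where bs: "w = concat bs" "set bs \<subseteq> blocks"
    by (auto simp: dwords_def)
  show "w = [] \<or> (\<exists>v\<in>dwords. w = None # v \<or> (\<exists>i. w = Some i # Some i # v))"
  proof (cases bs)
    case (Cons b bs')
    then have "concat bs' \<in> dwords" "b \<in> blocks" "w = b @ concat bs'"
      using bs by (auto simp: dwords_def)
    then show ?thesis by (auto simp: blocks_def)
  qed (use bs in simp)
next
  assume "w = [] \<or> (\<exists>v\<in>dwords. w = None # v \<or> (\<exists>i. w = Some i # Some i # v))"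
  then show "w \<in> dwords"
    using block_append_dwords[of "[None]"] block_append_dwords[of "[Some i, Some i]" for i]
    by (fastforce simp: blocks_def)
qed

lemma dwords_Cons [simp]:
  "None # w \<in> dwords \<longleftrightarrow> w \<in> dwords"
  "[Some i] \<notin> dwords"
  "Some i # None # w \<notin> dwords"
  "Some i # Some j # w \<in> dwords \<longleftrightarrow> i = j \<and> w \<in> dwords"
  by (subst dwords_iff; auto)+

lemma linear_expect: "linear (expect t)"
  by (simp add: expect_def)

lemmas expect_simps =
  linear_add[OF linear_expect] linear_diff[OF linear_expect]
  linear_scale[OF linear_expect] linear_sum[OF linear_expect]
  linear_0[OF linear_expect] linear_neg[OF linear_expect]

lemma expect_of_word:
  "expect t (of_word w) = (if w \<in> dwords
     then t ^ num_block w / (2 ^ num_pair w * fact (num_block w)) else 0)"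
  by (simp add: expect_def)

lemma expect_one [simp]: "expect t (of_word []) = 1"
  by (simp add: expect_of_word num_block_def num_pair_def num_zero_def)

lemma num_block_simps [simp]:
  "num_block [] = 0" "num_pair [] = 0"
  "num_block (None # w) = Suc (num_block w)" "num_pair (None # w) = num_pair w"
  "num_block (Some i # Some j # w) = Suc (num_block w)"
  "num_pair (Some i # Some j # w) = Suc (num_pair w)"
  by (simp_all add: num_block_def num_pair_def num_zero_def)

text \<open>The generator of the signature of time and Brownian motion.\<close>

definition generator :: "('d::finite) walg \<Rightarrow> 'd walg" where
  "generator p = left_deriv None p
     + (1/2) *\<^sub>R (\<Sum>i\<in>UNIV. left_deriv (Some i) (left_deriv (Some i) p))"

lemma linear_generator: "linear generator"
  unfolding generator_def
  by (rule linearI) (simp_all add: left_deriv_simps sum.distrib scaleR_add_right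
      scaleR_sum_right algebra_simps)

lemmas generator_simps =
  linear_add[OF linear_generator] linear_diff[OF linear_generator]
  linear_scale[OF linear_generator] linear_sum[OF linear_generator]
  linear_0[OF linear_generator] linear_neg[OF linear_generator]

lemma generator_words [simp]:
  "generator (of_word []) = 0"
  "generator (of_word (None # w)) = of_word w"
  "generator (of_word [Some i]) = 0"
  "generator (of_word (Some i # None # w)) = 0"
  "generator (of_word (Some i # Some j # w)) = (if i = j then (1/2) *\<^sub>R of_word w else 0)"
proof -
  have "left_deriv (Some k) (left_deriv (Some k) (of_word (Some i # Some j # w)))
      = (if k = i then if i = j then of_word w else 0 else 0)" for k
    by (auto simp: left_deriv_simps)
  then show "generator (of_word (Some i # Some j # w)) = (if i = j then (1/2) *\<^sub>R of_word w else 0)"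
    by (simp add: generator_def)
  have "left_deriv (Some k) (left_deriv (Some k) (of_word (Some i # None # w))) = 0" for k
    by (auto simp: left_deriv_simps)
  then show "generator (of_word (Some i # None # w)) = 0"
    by (simp add: generator_def)
  have "left_deriv (Some k) (left_deriv (Some k) (of_word [Some i])) = 0" for k
    by (auto simp: left_deriv_simps)
  then show "generator (of_word [Some i]) = 0"
    by (simp add: generator_def)
qed (simp_all add: generator_def left_deriv_simps)

lemma DERIV_power_fact:
  "((\<lambda>s. s ^ Suc m / (c * fact (Suc m))) has_real_derivative s ^ m / (c * fact m)) (at s)"
proof -
  have "((\<lambda>s. s ^ Suc m / (c * fact (Suc m))) has_real_derivative
      (real (Suc m) * s ^ m) / (c * fact (Suc m))) (at s)"
    using DERIV_pow[of "Suc m" s] by (intro DERIV_cdivide) simp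
  moreover have "(real (Suc m) * s ^ m) / (c * fact (Suc m)) = s ^ m / (c * fact m)"
    by (simp add: fact_Suc del: of_nat_Suc)
  ultimately show ?thesis by simp
qed

text \<open>Stripping the first block lowers the exponent and the factorial in t^m/m! together,
  which is differentiation in time; the factor 1/2 of a pair block is the one in
  \<open>generator\<close>.\<close>

lemma DERIV_expect_of_word:
  "((\<lambda>s. expect s (of_word w)) has_real_derivative expect s (generator (of_word w))) (at s)"
proof -
  consider "w = []" | v where "w = None # v" | i where "w = [Some i]"
    | i v where "w = Some i # None # v" | i j v where "w = Some i # Some j # v"
    by (metis list.exhaust not_None_eq)
  then show ?thesis
  proof cases
    case 2
    then show ?thesis
      using DERIV_power_fact[of "num_block v" "2 ^ num_pair w"]
      by (simp add: expect_of_word expect_simps del: fact_Suc power_Suc)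
  next
    case 5
    have "(\<lambda>s. expect s (of_word w)) = (\<lambda>s. if i = j \<and> v \<in> dwords
        then s ^ Suc (num_block v) / ((2 * 2 ^ num_pair v) * fact (Suc (num_block v))) else 0)"
      using 5 by (auto simp: fun_eq_iff expect_of_word simp del: fact_Suc)
    then show ?thesis
      using DERIV_power_fact[of "num_block v" "2 * 2 ^ num_pair v" s] 5
      by (simp add: expect_of_word expect_simps mult_ac del: fact_Suc power_Suc)
  qed (simp_all add: expect_simps expect_of_word)
qed

lemma DERIV_expect:
  "((\<lambda>s. expect s p) has_real_derivative expect s (generator p)) (at s)"
proof -
  have "((\<lambda>s. \<Sum>w\<in>Poly_Mapping.keys p. Poly_Mapping.lookup p w * expect s (of_word w))
      has_real_derivative
      (\<Sum>w\<in>Poly_Mapping.keys p. Poly_Mapping.lookup p w * expect s (generator (of_word w)))) (at s)"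
    by (intro DERIV_sum DERIV_cmult DERIV_expect_of_word)
  moreover have "expect s (generator p) =
      (\<Sum>w\<in>Poly_Mapping.keys p. Poly_Mapping.lookup p w * expect s (generator (of_word w)))"
    using linear_expand[OF linear_compose[OF linear_generator linear_expect], of s p] by simp
  moreover have "(\<lambda>s. expect s p) =
      (\<lambda>s. \<Sum>w\<in>Poly_Mapping.keys p. Poly_Mapping.lookup p w * expect s (of_word w))"
    using linear_expand[OF linear_expect, of _ p] by auto
  ultimately show ?thesis by simp
qed

lemma num_block_eq_0_iff: "w \<in> dwords \<Longrightarrow> num_block w = 0 \<longleftrightarrow> w = []"
  by (subst (asm) dwords_iff) auto

lemma expect_0: "expect 0 p = Poly_Mapping.lookup p []"
  by (rule linear_eqI[where p = p, OF linear_expect lookup_linear])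
    (auto simp: expect_of_word lookup_of_word num_block_eq_0_iff power_0_left)

text \<open>The \<^emph>\<open>carre du champ\<close> identity: the generator is a second order differential operator.\<close>

lemma generator_shuffle:
  "generator (shuffle p q) = shuffle (generator p) q + shuffle p (generator q)
     + (\<Sum>i\<in>UNIV. shuffle (left_deriv (Some i) p) (left_deriv (Some i) q))"
proof -
  have "(1/2) *\<^sub>R (\<Sum>i\<in>UNIV. left_deriv (Some i) (left_deriv (Some i) (shuffle p q)))
    = (1/2) *\<^sub>R (\<Sum>i\<in>UNIV. shuffle (left_deriv (Some i) (left_deriv (Some i) p)) q)
    + (1/2) *\<^sub>R (\<Sum>i\<in>UNIV. shuffle p (left_deriv (Some i) (left_deriv (Some i) q)))
    + (1/2) *\<^sub>R (2 *\<^sub>R (\<Sum>i\<in>UNIV. shuffle (left_deriv (Some i) p) (left_deriv (Some i) q)))"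
    unfolding scaleR_add_right[symmetric] scaleR_2 sum.distrib[symmetric]
    by (simp add: left_deriv_shuffle left_deriv_simps algebra_simps)
  then show ?thesis
    by (simp add: generator_def left_deriv_shuffle shuffle_simps algebra_simps)
qed

section \<open>Degree filtration and the flow of the generator\<close>

definition deg_le :: "nat \<Rightarrow> ('a list \<Rightarrow>\<^sub>0 real) \<Rightarrow> bool" where
  "deg_le n p \<longleftrightarrow> (\<forall>w. n < length w \<longrightarrow> Poly_Mapping.lookup p w = 0)"

lemma deg_le_add: "deg_le n p \<Longrightarrow> deg_le n q \<Longrightarrow> deg_le n (p + q)"
  and deg_le_scaleR: "deg_le n p \<Longrightarrow> deg_le n (c *\<^sub>R p)"
  and deg_le_0: "deg_le n 0"
  by (simp_all add: deg_le_def lookup_add lookup_scaleR)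

lemma deg_le_sum: "(\<And>i. i \<in> A \<Longrightarrow> deg_le n (f i)) \<Longrightarrow> deg_le n (sum f A)"
  by (simp add: deg_le_def lookup_sum)

lemma deg_le_mono: "deg_le m p \<Longrightarrow> m \<le> n \<Longrightarrow> deg_le n p"
  by (auto simp: deg_le_def)

lemma deg_le_of_word: "deg_le n (of_word w) \<longleftrightarrow> length w \<le> n"
  by (auto simp: deg_le_def lookup_of_word not_le)

lemma deg_le_exists: "\<exists>n. deg_le n p"
proof -
  have "length w \<le> Max (length ` Poly_Mapping.keys p)" if "Poly_Mapping.lookup p w \<noteq> 0" for w
    using that by (intro Max_ge) (auto simp: in_keys_iff)
  then show ?thesis unfolding deg_le_def by (meson not_le)
qed

lemma deg_le_left_deriv: "deg_le (Suc n) p \<Longrightarrow> deg_le n (left_deriv a p)"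
  by (simp add: deg_le_def lookup_left_deriv)

lemma left_deriv_eq_0: "deg_le 0 p \<Longrightarrow> left_deriv a p = 0"
  by (rule poly_mapping_eqI) (simp add: deg_le_def lookup_left_deriv)

lemma deg_le_generator: "deg_le (Suc n) p \<Longrightarrow> deg_le n (generator p)"
  unfolding generator_def
  by (intro deg_le_add deg_le_scaleR deg_le_sum deg_le_left_deriv)
    (auto intro: deg_le_mono deg_le_left_deriv)

lemma generator_eq_0: "deg_le 0 p \<Longrightarrow> generator p = 0"
  by (simp add: generator_def left_deriv_eq_0 left_deriv_simps)

lemma deg_le_generator_pow: "deg_le n p \<Longrightarrow> deg_le (n - k) ((generator ^^ k) p)"
proof (induction k)
  case (Suc k)
  then show ?case
    using deg_le_generator[of "n - Suc k" "(generator ^^ k) p"]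
      generator_eq_0[of "(generator ^^ k) p"]
    by (cases "k < n") (auto simp: Suc_diff_Suc deg_le_0)
qed simp

text \<open>Local nilpotency turns the exponential of the generator into a finite sum, so no
  convergence question arises.\<close>

lemma generator_pow_eq_0:
  assumes "deg_le n p" shows "(generator ^^ Suc n) p = 0"
  using deg_le_generator_pow[OF assms, of n] by (simp add: generator_eq_0)

text \<open>The truncated series of exp(r L) with L the \<open>generator\<close>; it is exact once
  \<open>N\<close> bounds the degree of \<open>p\<close>.\<close>

definition flow :: "nat \<Rightarrow> real \<Rightarrow> ('d::finite) walg \<Rightarrow> 'd walg" where
  "flow N r p = (\<Sum>j\<le>N. (r ^ j / fact j) *\<^sub>R (generator ^^ j) p)"

lemma flow_0 [simp]: "flow N 0 p = p"
proof -
  have "flow N 0 p = (\<Sum>j\<le>N. if j = 0 then p else 0)"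
    unfolding flow_def by (rule sum.cong) auto
  then show ?thesis by simp
qed

lemma deg_le_flow: "deg_le n p \<Longrightarrow> deg_le n (flow N r p)"
  unfolding flow_def
  by (intro deg_le_sum deg_le_scaleR) (meson deg_le_generator_pow deg_le_mono diff_le_self)

text \<open>
  The coefficients of \<open>flow N r p\<close> differentiate in \<open>r\<close> to those of \<open>generator (flow N r p)\<close>,
  provided that the truncation order \<open>N\<close> is large enough.
\<close>

lemma flow_derivative:
  assumes "deg_le N p"
  shows "(\<Sum>j\<le>N. (if j = 0 then 0 else r ^ (j - 1) / fact (j - 1)) *\<^sub>R (generator ^^ j) p)
    = generator (flow N r p)"
proof -
  have "generator (flow N r p) = (\<Sum>j\<le>N. (r ^ j / fact j) *\<^sub>R (generator ^^ Suc j) p)"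
    by (simp add: flow_def generator_simps)
  also have "\<dots> = (\<Sum>j<N. (r ^ j / fact j) *\<^sub>R (generator ^^ Suc j) p)"
    by (simp only: lessThan_Suc_atMost[symmetric] sum.lessThan_Suc generator_pow_eq_0[OF assms]) simp
  also have "\<dots> = (\<Sum>j<Suc N. (if j = 0 then 0 else r ^ (j - 1) / fact (j - 1)) *\<^sub>R (generator ^^ j) p)"
    by (subst sum.lessThan_Suc_shift) simp
  finally show ?thesis by (simp only: lessThan_Suc_atMost)
qed

lemma DERIV_flow_coeff:
  "((\<lambda>s. (t - s) ^ j / fact j) has_real_derivative
     - (if j = 0 then 0 else (t - s) ^ (j - 1) / fact (j - 1))) (at s)"
proof (cases j)
  case (Suc m)
  have "((\<lambda>s. (t - s) ^ Suc m / (1 * fact (Suc m))) has_real_derivative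
      (t - s) ^ m / (1 * fact m) * (- 1)) (at s)"
    by (rule DERIV_chain2[OF DERIV_power_fact]) (auto intro!: derivative_eq_intros)
  then show ?thesis using Suc by (simp del: fact_Suc power_Suc)
qed simp

text \<open>The forward equation for \<open>expect s\<close> and the backward equation for the flow
  contribute opposite terms.\<close>

lemma DERIV_expect_flow:
  assumes "deg_le N p"
  shows "((\<lambda>s. expect s (flow N (t - s) p)) has_real_derivative 0) (at s)"
proof -
  let ?c = "\<lambda>s j. (t - s) ^ j / fact j"
  let ?c' = "\<lambda>s j. if j = 0 then 0 else (t - s) ^ (j - 1) / fact (j - 1)"
  let ?q = "\<lambda>j. (generator ^^ j) p"
  have eq: "expect s (flow N (t - s) p) = (\<Sum>j\<le>N. ?c s j * expect s (?q j))" for s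
    by (simp add: flow_def expect_simps)
  have "((\<lambda>s. \<Sum>j\<le>N. ?c s j * expect s (?q j)) has_real_derivative
      (\<Sum>j\<le>N. ?c s j * expect s (generator (?q j)) + - ?c' s j * expect s (?q j))) (at s)"
    by (intro DERIV_sum DERIV_mult' DERIV_flow_coeff DERIV_expect)
  also have "(\<Sum>j\<le>N. ?c s j * expect s (generator (?q j)) + - ?c' s j * expect s (?q j))
      = expect s (generator (flow N (t - s) p))
        - expect s (\<Sum>j\<le>N. ?c' s j *\<^sub>R ?q j)"
    by (simp add: flow_def expect_simps generator_simps sum.distrib sum_negf sum_subtractf)
  also have "\<dots> = 0" by (simp only: flow_derivative[OF assms])
  finally show ?thesis by (simp only: eq)
qed

lemma expect_eq_flow:
  assumes "deg_le N p"
  shows "expect t p = Poly_Mapping.lookup (flow N t p) []"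
proof -
  have "expect t (flow N (t - t) p) = expect 0 (flow N (t - 0) p)"
    using DERIV_isconst_all[of "\<lambda>s. expect s (flow N (t - s) p)"] DERIV_expect_flow[OF assms]
    by blast
  then show ?thesis by (simp add: expect_0)
qed

lemma shuffle_sums:
  "shuffle (\<Sum>j\<in>A. a j *\<^sub>R p j) (\<Sum>k\<in>B. b k *\<^sub>R q k)
     = (\<Sum>j\<in>A. \<Sum>k\<in>B. (a j * b k) *\<^sub>R shuffle (p j) (q k))"
  unfolding linear_sum[OF shuffle_linear_left] o_def
  by (simp add: shuffle_simps(2,4,6,8) linear_scale[OF shuffle_linear_left] scaleR_sum_right mult.commute)

text \<open>Of the three terms of \<open>generator_shuffle\<close>, the two with the generator on
  one factor cancel against the time derivative of the flow; only the carre du champ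
  survives.\<close>

lemma DERIV_expect_flow_square:
  assumes "deg_le N p"
  shows "((\<lambda>s. expect s (shuffle (flow N (t - s) p) (flow N (t - s) p))) has_real_derivative
    (\<Sum>i\<in>UNIV. expect s (shuffle (left_deriv (Some i) (flow N (t - s) p))
                                 (left_deriv (Some i) (flow N (t - s) p))))) (at s)"
proof -
  let ?c = "\<lambda>s j. (t - s) ^ j / fact j"
  let ?c' = "\<lambda>s j. if j = 0 then 0 else (t - s) ^ (j - 1) / fact (j - 1)"
  let ?q = "\<lambda>j. (generator ^^ j) p"
  let ?f = "flow N (t - s) p"
  have eq: "expect s (shuffle (flow N (t - s) p) (flow N (t - s) p))
      = (\<Sum>j\<le>N. \<Sum>k\<le>N. (?c s j * ?c s k) * expect s (shuffle (?q j) (?q k)))" for s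
    by (simp only: flow_def shuffle_sums expect_simps real_scaleR_def)
  have "((\<lambda>s. \<Sum>j\<le>N. \<Sum>k\<le>N. (?c s j * ?c s k) * expect s (shuffle (?q j) (?q k)))
      has_real_derivative
      (\<Sum>j\<le>N. \<Sum>k\<le>N. (?c s j * ?c s k) * expect s (generator (shuffle (?q j) (?q k)))
        + (?c s j * - ?c' s k + - ?c' s j * ?c s k) * expect s (shuffle (?q j) (?q k)))) (at s)"
    by (intro DERIV_sum DERIV_mult' DERIV_flow_coeff DERIV_expect)
  also have "(\<Sum>j\<le>N. \<Sum>k\<le>N. (?c s j * ?c s k) * expect s (generator (shuffle (?q j) (?q k)))
        + (?c s j * - ?c' s k + - ?c' s j * ?c s k) * expect s (shuffle (?q j) (?q k)))
      = expect s (generator (shuffle ?f ?f))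
        - expect s (shuffle ?f (\<Sum>k\<le>N. ?c' s k *\<^sub>R ?q k))
        - expect s (shuffle (\<Sum>j\<le>N. ?c' s j *\<^sub>R ?q j) ?f)"
    unfolding flow_def shuffle_sums
    by (simp add: generator_simps expect_simps sum_subtractf[symmetric] sum.distrib[symmetric] algebra_simps)
  also have "\<dots> = (\<Sum>i\<in>UNIV. expect s (shuffle (left_deriv (Some i) ?f) (left_deriv (Some i) ?f)))"
    by (simp only: flow_derivative[OF assms] generator_shuffle expect_simps)
  finally show ?thesis by (simp only: eq)
qed

text \<open>
  Along the interpolation \<open>s \<mapsto> expect s (f\<^sup>2)\<close> with \<open>f = flow (t - s) p\<close>, which runs from the
  squared expectation to the second moment, the derivative is a sum of second moments of elements
  of smaller degree.
\<close>

lemma expect_square_ge: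
  fixes p :: "('d::finite) walg"
  assumes "deg_le n p" "0 \<le> t"
  shows "(expect t p)\<^sup>2 \<le> expect t (shuffle p p)"
  using assms
\<comment> \<open>The time varies too, since the induction hypothesis is applied at the intermediate
  times s.\<close>
proof (induction n arbitrary: p t)
  case 0
  have "expect t p = Poly_Mapping.lookup p []"
    using expect_eq_flow[OF 0(1), of t] by (simp add: flow_def)
  moreover have "p = Poly_Mapping.lookup p [] *\<^sub>R of_word []"
    using 0 by (intro poly_mapping_eqI) (auto simp: deg_le_def lookup_scaleR lookup_of_word)
  then have "shuffle p p = (Poly_Mapping.lookup p [])\<^sup>2 *\<^sub>R of_word []"
    by (metis power2_eq_square scaleR_scaleR shuffle_one_left shuffle_simps(5))
  ultimately show ?case by (simp add: expect_simps)
next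
  case (Suc n)
  let ?f = "\<lambda>s. flow (Suc n) (t - s) p"
  have "expect 0 (shuffle (?f 0) (?f 0)) \<le> expect t (shuffle (?f t) (?f t))"
  proof (rule DERIV_nonneg_imp_nondecreasing[OF Suc.prems(2)])
    fix s :: real assume s: "0 \<le> s" "s \<le> t"
    have "0 \<le> expect s (shuffle (left_deriv a (?f s)) (left_deriv a (?f s)))" for a
      using Suc.IH[OF deg_le_left_deriv[OF deg_le_flow] s(1)] Suc.prems(1)
      by (meson order_trans zero_le_power2)
    then have "0 \<le> (\<Sum>i\<in>UNIV. expect s (shuffle (left_deriv (Some i) (?f s)) (left_deriv (Some i) (?f s))))"
      by (intro sum_nonneg)
    then show "\<exists>y. ((\<lambda>s. expect s (shuffle (?f s) (?f s))) has_real_derivative y) (at s) \<and> 0 \<le> y"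
      using DERIV_expect_flow_square[OF Suc.prems(1)] by blast
  qed
  \<comment> \<open>At s = 0 the expectation is the counit, a character, and the counit of the
    flowed element is \<open>expect t p\<close>.\<close>
  then show ?case
    using expect_eq_flow[OF Suc.prems(1), of t]
    by (simp add: expect_0 lookup_Nil_shuffle power2_eq_square)
qed

lemma expect_square_nonneg:
  fixes p :: "('d::finite) walg"
  shows "0 \<le> t \<Longrightarrow> 0 \<le> expect t (shuffle p p)"
  using deg_le_exists[of p] expect_square_ge[of _ p t] by (meson order_trans zero_le_power2)

section \<open>Strict positivity of one variance\<close>

lemma generator_pow_zeros:
  "(generator ^^ j) (of_word (replicate k None @ [Some i])) =
     (if j \<le> k then of_word (replicate (k - j) None @ [Some i]) else 0)"
proof (induction j)
  case (Suc j)
  show ?case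
  proof (cases "j < k")
    case True
    then have "k - j = Suc (k - Suc j)" by simp
    then show ?thesis using Suc True by (simp del: diff_Suc_Suc)
  next
    case False
    then show ?thesis using Suc by (cases "j = k") (auto simp: generator_simps)
  qed
qed simp

lemma generator_Some_zeros: "generator (of_word (Some i # replicate k None)) = 0"
  by (cases k) simp_all

text \<open>This is the integrand of the Wiener integral. From 0...0i only the k-th power of the
  generator reaches the word i, while the reversed word starts with i0 and is killed by the
  generator, so only its zeroth term remains.\<close>

lemma left_deriv_flow_zeros:
  fixes i :: "'d::finite"
  assumes "k > 0"
  shows "left_deriv (Some i) (flow (Suc k) r
      (of_word (replicate k None @ [Some i]) + c *\<^sub>R of_word (Some i # replicate k None)))
    = (r ^ k / fact k) *\<^sub>R of_word [] + c *\<^sub>R of_word (replicate k None)" (is "?L (?u + c *\<^sub>R ?v) = ?R")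
proof -
  have pow: "(generator ^^ j) (p + q) = (generator ^^ j) p + (generator ^^ j) q"
    "(generator ^^ j) (c *\<^sub>R p) = c *\<^sub>R (generator ^^ j) p" for j and p q :: "'d walg"
    by (induction j) (simp_all add: generator_simps)
  have z: "(generator ^^ j) (0 :: 'd walg) = 0" for j
    by (induction j) (simp_all add: generator_simps)
  have v: "(generator ^^ j) ?v = (if j = 0 then ?v else 0)" for j
    by (cases j) (simp_all add: funpow_swap1[symmetric] generator_Some_zeros z del: funpow.simps,
        simp add: funpow_Suc_right generator_Some_zeros z del: funpow.simps)
  have u: "left_deriv (Some i) (of_word (replicate m None @ [Some i])) =
      (if m = 0 then of_word [] else 0)" for m
    by (cases m) auto
  have "?L (?u + c *\<^sub>R ?v) = (\<Sum>j\<le>Suc k. (if j = k then (r ^ k / fact k) *\<^sub>R of_word [] else 0))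
      + (\<Sum>j\<le>Suc k. if j = 0 then c *\<^sub>R of_word (replicate k None) else 0)"
    unfolding flow_def sum.distrib[symmetric] left_deriv_simps
    by (intro sum.cong refl)
      (auto simp: pow v u generator_pow_zeros left_deriv_simps scaleR_add_right)
  then show ?thesis by (simp add: sum.delta)
qed

lemma expect_zeros: "expect s (of_word (replicate k (None :: 'd option))) = s ^ k / fact k"
proof -
  let ?w = "replicate k (None :: 'd option)"
  have "?w \<in> dwords" "num_block ?w = k" "num_pair ?w = 0"
    by (induction k) auto
  then show ?thesis by (simp add: expect_of_word)
qed

text \<open>
  The multiple integral indexed by \<open>0\<dots>0i\<close> plus or minus its reversal is a multiple of the Wiener
  integral of \<open>s\<^sup>k \<plusminus> (t - s)\<^sup>k\<close>, which is not constant.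
\<close>

lemma variance_zeros_pos:
  fixes i :: "'d::finite"
  assumes "k > 0" "t > 0" "\<bar>c\<bar> = 1"
  defines "p \<equiv> of_word (replicate k None @ [Some i]) + c *\<^sub>R of_word (Some i # replicate k None)"
  shows "(expect t p)\<^sup>2 < expect t (shuffle p p)"
proof -
  let ?f = "\<lambda>s. flow (Suc k) (t - s) p"
  let ?g = "\<lambda>s. expect s (shuffle (?f s) (?f s))"
  let ?d = "\<lambda>s j. expect s (shuffle (left_deriv (Some j) (?f s)) (left_deriv (Some j) (?f s)))"
  have deg: "deg_le (Suc k) p"
    unfolding p_def by (intro deg_le_add deg_le_scaleR) (simp_all add: deg_le_of_word)
  note D = DERIV_expect_flow_square[OF deg, of t]
  have nonneg: "0 \<le> ?d s j" if "0 \<le> s" for s j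
    using that by (rule expect_square_nonneg)
  \<comment> \<open>For s up to t/3 one has s < t - s, so the two powers cannot cancel, whatever the
    sign of \<open>c\<close>; any cut point strictly between 0 and t/2 would do. Past it,
    monotonicity suffices.\<close>
  have "?g 0 < ?g (t / 3)"
  proof (rule DERIV_pos_imp_increasing[where f = ?g])
    fix s assume s: "0 \<le> s" "s \<le> t / 3"
    have "\<bar>c * (s ^ k / fact k)\<bar> < (t - s) ^ k / fact k"
      using s assms by (simp add: abs_mult divide_strict_right_mono power_strict_mono)
    then have "0 < (t - s) ^ k / fact k + c * (s ^ k / fact k)"
      using abs_ge_minus_self[of "c * (s ^ k / fact k)"] by (simp only: add.commute) argo
    then have "0 < ((t - s) ^ k / fact k + c * (s ^ k / fact k))\<^sup>2"
      by simp
    also have "\<dots> = (expect s (left_deriv (Some i) (?f s)))\<^sup>2"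
      by (simp add: p_def left_deriv_flow_zeros[OF assms(1)] expect_simps expect_zeros)
    also have "\<dots> \<le> ?d s i"
      using expect_square_ge[OF deg_le_left_deriv[OF deg_le_flow[OF deg]]] s by blast
    also have "\<dots> \<le> (\<Sum>j\<in>UNIV. ?d s j)"
      by (rule member_le_sum) (use s nonneg in auto)
    finally show "\<exists>y. (?g has_real_derivative y) (at s) \<and> 0 < y"
      using D by blast
  qed (use assms in simp)
  also have "?g (t / 3) \<le> ?g t"
  proof (rule DERIV_nonneg_imp_nondecreasing[where f = ?g])
    fix s assume "t / 3 \<le> s"
    then have "0 \<le> (\<Sum>j\<in>UNIV. ?d s j)"
      using assms by (intro sum_nonneg nonneg) simp
    then show "\<exists>y. (?g has_real_derivative y) (at s) \<and> 0 \<le> y"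
      using D by blast
  qed (use assms in simp)
  finally show ?thesis
    using expect_eq_flow[OF deg, of t]
    by (simp add: expect_0 lookup_Nil_shuffle power2_eq_square)
qed

section \<open>Convolution on words\<close>

text \<open>Convolution of values on basis words only. The recursion moves letters of the word into
  the first argument, so proofs by induction on the word generalise over that argument.\<close>

fun wconv :: "('a list \<Rightarrow> ('a list \<Rightarrow>\<^sub>0 real)) \<Rightarrow> ('a list \<Rightarrow> ('a list \<Rightarrow>\<^sub>0 real))
    \<Rightarrow> 'a list \<Rightarrow> ('a list \<Rightarrow>\<^sub>0 real)" where
  "wconv f g [] = shuffle (f []) (g [])"
| "wconv f g (a # w) = shuffle (f []) (g (a # w)) + wconv (\<lambda>u. f (a # u)) g w"

lemma splits_Cons:
  "{(u, v). u @ v = a # w} = insert ([], a # w) ((\<lambda>(u, v). (a # u, v)) ` {(u, v). u @ v = w})"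
  by (auto simp: append_eq_Cons_conv)

lemma finite_splits [simp]: "finite {(u, v). u @ v = w}"
  by (induction w) (simp_all add: splits_Cons)

lemma wconv_eq_sum: "wconv f g w = (\<Sum>(u, v)\<in>{(u, v). u @ v = w}. shuffle (f u) (g v))"
proof (induction w arbitrary: f)
  case (Cons a w)
  have "inj_on (\<lambda>x. (a # fst x, snd x)) A" for A :: "('a list \<times> 'a list) set"
    by (auto simp: inj_on_def)
  then show ?case
    unfolding splits_Cons wconv.simps Cons.IH
    by (subst sum.insert) (auto simp: sum.reindex case_prod_beta)
qed simp

text \<open>Only prefixes and suffixes of the word enter. This locality lets truncated functions
  replace untruncated ones on short words.\<close>

lemma wconv_cong:
  assumes "\<And>u v. u @ v = w \<Longrightarrow> f u = f' u" "\<And>u v. u @ v = w \<Longrightarrow> g v = g' v"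
  shows "wconv f g w = wconv f' g' w"
  unfolding wconv_eq_sum by (rule sum.cong) (use assms in auto)

lemma wconv_linear [simp]:
  "wconv (\<lambda>u. f u + f' u) g w = wconv f g w + wconv f' g w"
  "wconv (\<lambda>u. f u - f' u) g w = wconv f g w - wconv f' g w"
  "wconv (\<lambda>u. c *\<^sub>R f u) g w = c *\<^sub>R wconv f g w"
  "wconv f (\<lambda>v. g v + g' v) w = wconv f g w + wconv f g' w"
  "wconv f (\<lambda>v. g v - g' v) w = wconv f g w - wconv f g' w"
  "wconv f (\<lambda>v. c *\<^sub>R g v) w = c *\<^sub>R wconv f g w"
  "wconv f (\<lambda>v. - g v) w = - wconv f g w"
  by (simp_all add: wconv_eq_sum shuffle_simps case_prod_beta sum.distrib sum_subtractf sum_negf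
      scaleR_sum_right)

lemma wconv_0 [simp]: "wconv (\<lambda>u. 0) g w = 0" "wconv f (\<lambda>v. 0) w = 0"
  by (simp_all add: wconv_eq_sum shuffle_simps case_prod_beta)

lemma wconv_sum:
  "wconv (\<lambda>u. \<Sum>j\<in>A. h j u) g w = (\<Sum>j\<in>A. wconv (h j) g w)"
  "wconv f (\<lambda>v. \<Sum>j\<in>A. h j v) w = (\<Sum>j\<in>A. wconv f (h j) w)"
  by (induction A rule: infinite_finite_induct) simp_all

lemma wconv_shuffle_left: "wconv (\<lambda>u. shuffle p (f u)) g w = shuffle p (wconv f g w)"
  by (simp add: wconv_eq_sum shuffle_simps case_prod_beta shuffle_assoc)

lemma wconv_assoc: "wconv (wconv f g) h w = wconv f (wconv g h) w"
  by (induction w arbitrary: f g)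
    (simp_all add: shuffle_simps shuffle_assoc wconv_shuffle_left add.assoc)

definition wone :: "'a list \<Rightarrow> ('a list \<Rightarrow>\<^sub>0 real)" where
  "wone w = (if w = [] then of_word [] else 0)"

lemma wconv_Nil_left: "wconv (\<lambda>u. if u = [] then p else 0) g w = shuffle p (g w)"
  by (cases w) simp_all

lemma wconv_one_left [simp]: "wconv wone g w = g w"
  using wconv_Nil_left[of "of_word []" g w] by (simp add: wone_def[abs_def])

lemma wconv_one_right [simp]: "wconv f wone w = f w"
  by (induction w arbitrary: f) (simp_all add: wone_def shuffle_simps)

lemma wconv_snoc:
  "wconv f g (w @ [b]) = shuffle (f (w @ [b])) (g []) + wconv f (\<lambda>v. g (v @ [b])) w"
  by (induction w arbitrary: f) (simp_all add: algebra_simps)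

lemma wconv_split_ends:
  assumes "w \<noteq> []"
  shows "wconv f g w = shuffle (f []) (g w) + shuffle (f w) (g [])
    + (\<Sum>(u, v)\<in>{(u, v). u @ v = w \<and> u \<noteq> [] \<and> v \<noteq> []}. shuffle (f u) (g v))"
proof -
  have "{(u, v). u @ v = w} =
      insert ([], w) (insert (w, []) {(u, v). u @ v = w \<and> u \<noteq> [] \<and> v \<noteq> []})"
    by auto
  moreover have "finite {(u, v). u @ v = w \<and> u \<noteq> [] \<and> v \<noteq> []}"
    by (rule finite_subset[OF _ finite_splits[of w]]) auto
  ultimately show ?thesis
    unfolding wconv_eq_sum using assms by (auto simp: add.assoc)
qed

text \<open>Cuts into two nonempty pieces see only shorter words and cancel in the difference; the
  two trivial cuts contribute one factor \<open>q\<close> each.\<close>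

lemma wconv_square_diff:
  assumes "f [] = q *\<^sub>R of_word []" "g [] = q *\<^sub>R of_word []" "w \<noteq> []"
    and "\<And>u. length u < length w \<Longrightarrow> f u = g u"
  shows "wconv f f w - wconv g g w = (2 * q) *\<^sub>R (f w - g w)"
proof -
  have "(\<Sum>(u, v)\<in>{(u, v). u @ v = w \<and> u \<noteq> [] \<and> v \<noteq> []}. shuffle (f u) (f v))
      = (\<Sum>(u, v)\<in>{(u, v). u @ v = w \<and> u \<noteq> [] \<and> v \<noteq> []}. shuffle (g u) (g v))"
    by (rule sum.cong) (use assms(4) in auto)
  moreover have "(2 * q) *\<^sub>R x = q *\<^sub>R x + q *\<^sub>R x" for x :: "'a list \<Rightarrow>\<^sub>0 real"
    by (metis mult_2 scaleR_left_distrib)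
  ultimately show ?thesis
    by (simp only: wconv_split_ends[OF assms(3)] assms(1,2) shuffle_simps
        shuffle_one_left shuffle_one_right) (simp add: scaleR_diff_right)
qed


section \<open>The antipode\<close>

definition wanti :: "'a list \<Rightarrow> ('a list \<Rightarrow>\<^sub>0 real)" where
  "wanti w = (- 1) ^ length w *\<^sub>R of_word (rev w)"

lemma left_deriv_wconv:
  "left_deriv c (wconv f g w)
     = wconv (\<lambda>u. left_deriv c (f u)) g w + wconv f (\<lambda>v. left_deriv c (g v)) w"
  by (simp add: wconv_eq_sum left_deriv_simps left_deriv_shuffle case_prod_beta sum.distrib)

lemma left_deriv_wanti:
  "left_deriv c (wanti w) = (if w \<noteq> [] \<and> c = last w then - wanti (butlast w) else 0)"
  by (cases w rule: rev_cases) (simp_all add: wanti_def left_deriv_simps)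

lemma lookup_Nil_wconv_eq_0:
  assumes "w \<noteq> []" "\<And>u. u \<noteq> [] \<Longrightarrow> Poly_Mapping.lookup (f u) [] = 0"
    "\<And>u. u \<noteq> [] \<Longrightarrow> Poly_Mapping.lookup (g u) [] = 0"
  shows "Poly_Mapping.lookup (wconv f g w) [] = 0"
  unfolding wconv_eq_sum lookup_sum
  by (rule sum.neutral) (use assms in \<open>auto simp: lookup_Nil_shuffle\<close>)

lemma lookup_Nil_wanti: "w \<noteq> [] \<Longrightarrow> Poly_Mapping.lookup (wanti w) [] = 0"
  by (simp add: wanti_def lookup_scaleR lookup_of_word)

text \<open>A left derivation strips the first letter from the \<open>of_word\<close> factor, or the
  last letter, with a minus sign, from the \<open>wanti\<close> factor. By induction both
  contributions vanish unless the word is a single letter, and then they cancel.\<close>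

lemma wconv_id_anti: "wconv of_word wanti w = wone w"
proof (induction "length w" arbitrary: w rule: less_induct)
  case less
  show ?case
  proof (cases "w = []")
    case True
    then show ?thesis by (simp add: wone_def wanti_def)
  next
    case False
    then obtain a w1 where w1: "w = a # w1" by (cases w) auto
    moreover obtain w2 b where "w = w2 @ [b]" using False by (cases w rule: rev_cases) auto
    ultimately have w: "w = a # w1" "w = w2 @ [b]" by auto
    have "left_deriv c (wconv of_word wanti w) = 0" for c
    proof -
      have "wconv (\<lambda>u. left_deriv c (of_word u)) wanti (a # w1)
          = (if c = a then wconv of_word wanti w1 else 0)"
        by (cases "c = a") (simp_all add: shuffle_simps)
      moreover have "wconv of_word (\<lambda>v. left_deriv c (wanti v)) (w2 @ [b])
          = (if c = b then - wconv of_word wanti w2 else 0)"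
        by (cases "c = b") (simp_all add: wconv_snoc shuffle_simps left_deriv_wanti
            wanti_def[of "[]"] left_deriv_simps)
      moreover have "wconv of_word wanti w1 = wone w1" "wconv of_word wanti w2 = wone w2"
        by (rule less; simp add: w(1)) (rule less; simp add: w(2))
      moreover have "w1 = [] \<longleftrightarrow> w2 = []" "w1 = [] \<Longrightarrow> a = b"
        using trans[OF w(1)[symmetric] w(2)] by (cases w2; simp)+
      ultimately show ?thesis
        by (subst left_deriv_wconv, subst w(1), subst w(2)) (simp add: wone_def)
    qed
    then show ?thesis
      using False
    by - (rule walg_eqI,
        simp_all add: wone_def left_deriv_simps lookup_of_word lookup_Nil_wconv_eq_0
          lookup_Nil_wanti)
  qed
qed

text \<open>Moving the letter \<open>c\<close> across the cut matches prefixes ending in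
  \<open>c\<close> with suffixes starting with \<open>c\<close>.\<close>

lemma wconv_cancel:
  "wconv (\<lambda>u. if u \<noteq> [] \<and> c = last u then f (butlast u) else 0) g w
     = wconv f (\<lambda>v. if v \<noteq> [] \<and> c = hd v then g (tl v) else 0) w"
proof (induction w arbitrary: f)
  case (Cons a w)
  have "(\<lambda>u. if a # u \<noteq> [] \<and> c = last (a # u) then f (butlast (a # u)) else 0)
      = (\<lambda>u. (if u \<noteq> [] \<and> c = last u then f (a # butlast u) else 0)
           + (if u = [] then if c = a then f [] else 0 else 0))"
    by auto
  then show ?case
    using Cons.IH[of "\<lambda>u. f (a # u)"] by (simp add: wconv_Nil_left shuffle_simps)
qed (simp add: shuffle_simps)

lemma wconv_anti_id: "wconv wanti of_word w = wone w"
proof (cases "w = []")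
  case True
  then show ?thesis by (simp add: wone_def wanti_def)
next
  case False
  have "left_deriv c (wconv wanti of_word w) = 0" for c
  proof -
    have "wconv (\<lambda>u. left_deriv c (wanti u)) of_word w =
        (- 1) *\<^sub>R wconv (\<lambda>u. if u \<noteq> [] \<and> c = last u then wanti (butlast u) else 0) of_word w"
      unfolding wconv_linear(3)[symmetric]
      by (rule arg_cong[where f = "\<lambda>f. wconv f of_word w"]) (auto simp: left_deriv_wanti)
    moreover have "left_deriv c (of_word v) = (if v \<noteq> [] \<and> c = hd v then of_word (tl v) else 0)" for v
      by (cases v) auto
    ultimately show ?thesis
      unfolding left_deriv_wconv wconv_cancel by simp
  qed
  then show ?thesis
    using False
    by - (rule walg_eqI,
      simp_all add: wone_def left_deriv_simps lookup_of_word lookup_Nil_wconv_eq_0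
        lookup_Nil_wanti)
qed


section \<open>The convolution algebra of endomorphisms\<close>

lemma conv_of_word:
  "(X \<star> Y) (of_word w) = wconv (\<lambda>u. X (of_word u)) (\<lambda>v. Y (of_word v)) w"
  by (simp add: conv_def wconv_eq_sum)

lemma linear_conv: "linear (X \<star> Y)"
  by (simp add: conv_def)

lemma linear_conv_unit: "linear \<nu>"
  by (simp add: conv_unit_def)

lemma conv_unit_of_word: "\<nu> (of_word w) = wone w"
  by (simp add: conv_unit_def wone_def)

lemma conv_assoc: "(X \<star> Y) \<star> Z = X \<star> (Y \<star> Z)"
  by (rule ext, rule linear_eqI[OF linear_conv linear_conv]) (simp add: conv_of_word wconv_assoc)

lemma conv_unit_left: "linear X \<Longrightarrow> \<nu> \<star> X = X"
  by (rule ext, rule linear_eqI[OF linear_conv]) (simp_all add: conv_of_word conv_unit_of_word)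

lemma conv_unit_right: "linear X \<Longrightarrow> X \<star> \<nu> = X"
  by (rule ext, rule linear_eqI[OF linear_conv]) (simp_all add: conv_of_word conv_unit_of_word)

lemma linear_antipode: "linear antipode"
  by (simp add: antipode_def)

lemma antipode_of_word: "antipode (of_word w) = wanti w"
  by (simp add: antipode_def wanti_def)

lemma conv_id_antipode: "id \<star> antipode = \<nu>"
  by (rule ext, rule linear_eqI[OF linear_conv linear_conv_unit])
    (simp add: conv_of_word conv_unit_of_word antipode_of_word wconv_id_anti)

lemma conv_antipode_id: "antipode \<star> id = \<nu>"
  by (rule ext, rule linear_eqI[OF linear_conv linear_conv_unit])
    (simp add: conv_of_word conv_unit_of_word antipode_of_word wconv_anti_id)

lemma conv_inv_id: "conv_inv id = antipode"
  unfolding conv_inv_def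
proof (rule the_equality)
  fix Y :: "'a endo"
  assume "linear Y \<and> id \<star> Y = \<nu> \<and> Y \<star> id = \<nu>"
  then show "Y = antipode"
    by (metis conv_assoc conv_antipode_id conv_unit_left conv_unit_right linear_antipode)
qed (simp add: linear_antipode conv_id_antipode conv_antipode_id)

lemma f_star_id: "f_star id \<epsilon> = (\<lambda>p. (1/2) *\<^sub>R (p - \<epsilon> *\<^sub>R antipode p))"
  by (simp add: f_star_def conv_inv_id)


section \<open>The convolution square root\<close>

fun wpow :: "('a list \<Rightarrow> ('a list \<Rightarrow>\<^sub>0 real)) \<Rightarrow> nat \<Rightarrow> 'a list \<Rightarrow> ('a list \<Rightarrow>\<^sub>0 real)" where
  "wpow f 0 = wone"
| "wpow f (Suc k) = wconv f (wpow f k)"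

lemma conv_pow_of_word: "conv_pow X k (of_word w) = wpow (\<lambda>u. X (of_word u)) k w"
proof (induction k arbitrary: w)
  case (Suc k)
  then show ?case by (simp add: conv_of_word)
qed (simp add: conv_unit_of_word)

lemma wpow_add: "wpow f (j + k) w = wconv (wpow f j) (wpow f k) w"
proof (induction j arbitrary: w)
  case (Suc j)
  then have "wpow f (j + k) = wconv (wpow f j) (wpow f k)" by blast
  then show ?case by (simp add: wconv_assoc)
qed simp

text \<open>A nonzero term needs a cut of the word into \<open>k\<close> nonempty pieces.\<close>

lemma wpow_eq_0:
  assumes "f [] = 0" "length w < k"
  shows "wpow f k w = 0"
  using assms(2)
proof (induction k arbitrary: w)
  case (Suc k)
  have "shuffle (f u) (wpow f k v) = 0" if "u @ v = w" for u v
    using that Suc assms(1) by (cases u) (auto simp: shuffle_simps)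
  then show ?case by (auto simp: wconv_eq_sum intro!: sum.neutral)
qed simp

text \<open>The binomial series for the square root of \<open>1 + f\<close>.\<close>

definition wsqrt :: "('a list \<Rightarrow> ('a list \<Rightarrow>\<^sub>0 real)) \<Rightarrow> 'a list \<Rightarrow> ('a list \<Rightarrow>\<^sub>0 real)" where
  "wsqrt f w = (\<Sum>k\<le>length w. ((1/2 :: real) gchoose k) *\<^sub>R wpow f k w)"

lemma wsqrt_superset:
  assumes "f [] = 0" "length w \<le> N"
  shows "wsqrt f w = (\<Sum>k\<le>N. ((1/2 :: real) gchoose k) *\<^sub>R wpow f k w)"
  unfolding wsqrt_def
  by (rule sum.mono_neutral_left) (use assms in \<open>auto simp: wpow_eq_0\<close>)

text \<open>Collecting terms by total power, Vandermonde's identity for 1/2 + 1/2 produces the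
  coefficients of (1 + f)^1, which vanish from the second power on.\<close>

lemma wsqrt_square:
  assumes "f [] = 0"
  shows "wconv (wsqrt f) (wsqrt f) w = wone w + f w"
proof -
  \<comment> \<open>The successor keeps both powers 0 and 1 within the range even for the empty
    word.\<close>
  define N where "N = Suc (length w)"
  let ?b = "\<lambda>k. (1/2 :: real) gchoose k"
  let ?s = "\<lambda>w. \<Sum>k\<le>N. ?b k *\<^sub>R wpow f k w"
  let ?g = "\<lambda>j k. (?b j * ?b k) *\<^sub>R wpow f (j + k) w"
  have "wconv (wsqrt f) (wsqrt f) w = wconv ?s ?s w"
    by (rule wconv_cong; rule wsqrt_superset[of f, OF assms]) (auto simp: N_def)
  also have "\<dots> = (\<Sum>j\<le>N. \<Sum>k\<le>N. ?g j k)"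
    by (simp add: wconv_sum wpow_add scaleR_sum_right)
  also have "\<dots> = (\<Sum>(j, k)\<in>{(j, k). j + k \<le> N}. ?g j k)"
    unfolding sum.cartesian_product
    by (rule sum.mono_neutral_right) (auto simp: N_def intro!: wpow_eq_0[where f = f] assms)
  also have "\<dots> = (\<Sum>m\<le>N. \<Sum>j\<le>m. ?g j (m - j))"
    by (rule sum.triangle_reindex_eq)
  also have "\<dots> = (\<Sum>m\<le>N. ((1 :: real) gchoose m) *\<^sub>R wpow f m w)"
    using gbinomial_Vandermonde[of "1/2 :: real" "1/2"]
    by (simp add: atMost_atLeast0 flip: scaleR_sum_left)
  also have "\<dots> = (\<Sum>m\<in>{0, 1}. ((1 :: real) gchoose m) *\<^sub>R wpow f m w)"
  proof (rule sum.mono_neutral_right)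
    show "\<forall>m\<in>{..N} - {0, 1}. ((1 :: real) gchoose m) *\<^sub>R wpow f m w = 0"
    proof
      fix m assume "m \<in> {..N} - {0, 1}"
      then have "(1 :: real) gchoose m = 0"
        using binomial_gbinomial[of 1 m, where 'a = real] by (simp add: binomial_eq_0)
      then show "((1 :: real) gchoose m) *\<^sub>R wpow f m w = 0" by simp
    qed
  qed (auto simp: N_def)
  finally show ?thesis by simp
qed

lemma conv_sqrt_of_word:
  assumes Z: "Z (of_word []) = c *\<^sub>R of_word []" and c: "c > 0"
  shows "conv_sqrt Z (of_word w) = sqrt c *\<^sub>R wsqrt (\<lambda>u. inverse c *\<^sub>R Z (of_word u) - wone u) w"
proof -
  let ?D = "\<lambda>p. inverse c *\<^sub>R Z p - \<nu> p"
  let ?d = "\<lambda>u. inverse c *\<^sub>R Z (of_word u) - wone u"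
  have c_eq: "Poly_Mapping.lookup (Z (of_word [])) [] = c"
    using Z by (simp add: lookup_scaleR lookup_of_word)
  have d: "?d [] = 0"
    using Z c by (simp add: wone_def)
  have pow: "conv_pow ?D k (of_word w) = wpow ?d k w" for k
    by (simp add: conv_pow_of_word conv_unit_of_word)
  have "Sum_any (\<lambda>k. ((1/2 :: real) gchoose k) *\<^sub>R wpow ?d k w) = wsqrt ?d w"
    unfolding wsqrt_def
    by (rule Sum_any.expand_superset) (use wpow_eq_0[of ?d, OF d, of w] in \<open>auto simp: not_le[symmetric]\<close>)
  then show ?thesis
    by (simp add: conv_sqrt_def Let_def c_eq pow)
qed

lemma conv_sqrt_square:
  assumes Z: "Z (of_word []) = c *\<^sub>R of_word []" and c: "c > 0"
  shows "wconv (\<lambda>u. conv_sqrt Z (of_word u)) (\<lambda>u. conv_sqrt Z (of_word u)) w = Z (of_word w)"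
proof -
  have "sqrt c * (sqrt c * inverse c) = 1"
    using c by (simp flip: mult.assoc)
  then show ?thesis
    using Z c unfolding conv_sqrt_of_word[of Z, OF Z c]
    by (simp add: wsqrt_square wone_def[of "[]"] scaleR_diff_right)
qed

lemma conv_sqrt_Nil:
  assumes Z: "Z (of_word []) = c *\<^sub>R of_word []" and c: "c > 0"
  shows "conv_sqrt Z (of_word []) = sqrt c *\<^sub>R of_word []"
  unfolding conv_sqrt_of_word[of Z, OF Z c] by (simp add: wsqrt_def wone_def)


section \<open>The remainder on words of length \<open>n + 1\<close>\<close>

lemma proj_of_word: "proj K (of_word w) = (if length w \<in> K then of_word w else 0)"
  by (simp add: proj_def)

lemma linear_proj: "linear (proj K)"
  by (simp add: proj_def)

lemma proj_wanti: "proj K (wanti w) = (if length w \<in> K then wanti w else 0)"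
  by (simp add: wanti_def linear_scale[OF linear_proj] proj_of_word)

lemma linear_f_star_id: "linear (f_star id \<epsilon>)"
  unfolding f_star_id
  by (rule linearI) (simp_all add: linear_add[OF linear_antipode] linear_scale[OF linear_antipode]
      algebra_simps)

lemma remainder_of_word:
  fixes \<epsilon> :: real and w :: "('d::finite) word"
  assumes "\<epsilon> > 0" and w: "length w = n + 1"
  shows "remainder n \<epsilon> (of_word w) = (1 / (1 + \<epsilon>)) *\<^sub>R (of_word w - \<epsilon> *\<^sub>R wanti w)"
proof -
  define F :: "'d word \<Rightarrow> 'd walg" where "F u = (1/2) *\<^sub>R (of_word u - \<epsilon> *\<^sub>R wanti u)" for u
  define G :: "'d word \<Rightarrow> 'd walg" where "G u = (1/2) *\<^sub>R (of_word u + \<epsilon> *\<^sub>R wanti u)" for u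
  define X :: "'d endo" where "X = proj {..n} \<circ> f_star id \<epsilon>"
  define Z :: "'d endo" where "Z = (\<lambda>q. conv_pow X 2 q + \<epsilon> *\<^sub>R \<nu> q)"
  define x where "x u = X (of_word u)" for u
  define Q where "Q u = conv_sqrt Z (of_word u)" for u
  have x: "x u = (if length u \<le> n then F u else 0)" for u
    by (simp add: x_def X_def F_def f_star_id antipode_of_word proj_of_word proj_wanti
        linear_scale[OF linear_proj] linear_diff[OF linear_proj])
  have "linear X"
    unfolding X_def by (intro linear_compose linear_f_star_id linear_proj)
  then have Z_word: "Z (of_word u) = wconv x x u + \<epsilon> *\<^sub>R wone u" for u
    by (simp add: Z_def numeral_2_eq_2 conv_unit_right conv_of_word conv_unit_of_word x_def[abs_def])
  have anti_Nil: "wanti [] = of_word []" by (simp add: wanti_def)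
  have F_Nil: "F [] = ((1 - \<epsilon>) / 2) *\<^sub>R of_word []"
    by (simp add: F_def anti_Nil algebra_simps flip: scaleR_left_diff_distrib)
  have G_Nil: "G [] = ((1 + \<epsilon>) / 2) *\<^sub>R of_word []"
    by (simp add: G_def anti_Nil algebra_simps add_divide_distrib)
  \<comment> \<open>The squares of \<open>F\<close> and \<open>G\<close> differ only in their mixed
    terms, where identity and antipode convolve to the unit.\<close>
  have GG: "wconv G G u = wconv F F u + \<epsilon> *\<^sub>R wone u" for u
    unfolding F_def[abs_def] G_def[abs_def]
    by (simp add: wconv_id_anti wconv_anti_id algebra_simps) (simp flip: scaleR_left.add)
  let ?c = "((1 + \<epsilon>) / 2)\<^sup>2"
  have Z_Nil: "Z (of_word []) = ?c *\<^sub>R of_word []"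
    by (simp add: Z_word x F_Nil wone_def shuffle_simps power2_eq_square
        flip: scaleR_left_distrib) (simp add: field_simps)
  have c_pos: "?c > 0" using assms(1) by simp
  have QQ: "wconv Q Q u = wconv x x u + \<epsilon> *\<^sub>R wone u" for u
    unfolding Q_def[abs_def] conv_sqrt_square[of Z, OF Z_Nil c_pos] by (rule Z_word)
  have Q_Nil: "Q [] = ((1 + \<epsilon>) / 2) *\<^sub>R of_word []"
    using conv_sqrt_Nil[of Z, OF Z_Nil c_pos] assms(1) by (simp add: Q_def)
  \<comment> \<open>Uniqueness of the root with a prescribed constant coefficient: the squares agree
    up to length \<open>n\<close>, and the factor 1 + \<epsilon> in their difference is
    nonzero.\<close>
  have Q_le: "Q u = G u" if "length u \<le> n" for u
    using that
  proof (induction "length u" arbitrary: u rule: less_induct)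
    case less
    show ?case
    proof (cases "u = []")
      case False
      have "wconv x x u = wconv F F u"
        by (rule wconv_cong) (use less.prems in \<open>auto simp: x\<close>)
      then have "(2 * ((1 + \<epsilon>) / 2)) *\<^sub>R (Q u - G u) = 0"
        using wconv_square_diff[of Q _ G, OF Q_Nil G_Nil False] less by (simp add: QQ GG)
      then show ?thesis using assms(1) by simp
    qed (simp add: Q_Nil G_Nil)
  qed
  have "w \<noteq> []" using w by auto
  have two: "2 * (y / 2) = y" for y :: real by simp
  \<comment> \<open>\<open>F\<close> and \<open>x\<close> have the same square defect as
    \<open>G\<close> and \<open>Q\<close>, since both pairs of squares are shifted by the same
    multiple of the unit. As \<open>x\<close> vanishes at \<open>w\<close>, this gives the defect of
    the root there.\<close>
  have "wconv F F w - wconv x x w = (2 * ((1 - \<epsilon>) / 2)) *\<^sub>R (F w - x w)"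
    by (rule wconv_square_diff[of F _ x, OF F_Nil _ \<open>w \<noteq> []\<close>]) (use w in \<open>auto simp: x F_Nil\<close>)
  moreover have "wconv G G w - wconv Q Q w = (2 * ((1 + \<epsilon>) / 2)) *\<^sub>R (G w - Q w)"
    by (rule wconv_square_diff[of G _ Q, OF G_Nil Q_Nil \<open>w \<noteq> []\<close>]) (use w in \<open>auto simp: Q_le\<close>)
  ultimately have "(1 + \<epsilon>) *\<^sub>R (G w - Q w) = (1 - \<epsilon>) *\<^sub>R F w"
    using w unfolding two by (simp add: QQ GG x)
  then have "inverse (1 + \<epsilon>) *\<^sub>R ((1 + \<epsilon>) *\<^sub>R (G w - Q w))
      = inverse (1 + \<epsilon>) *\<^sub>R ((1 - \<epsilon>) *\<^sub>R F w)"
    by (rule arg_cong)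
  moreover have "inverse (1 + \<epsilon>) * (1 + \<epsilon>) = 1"
    using assms(1) by simp
  ultimately have "G w - Q w = ((1 - \<epsilon>) / (1 + \<epsilon>)) *\<^sub>R F w"
    by (simp only: scaleR_scaleR scaleR_one divide_inverse mult.commute)
  moreover have "of_word w - G w = F w"
    by (simp add: F_def G_def algebra_simps flip: scaleR_left_distrib)
  moreover have "remainder n \<epsilon> (of_word w) = (of_word w - G w) + (G w - Q w)"
    using w x[of w] by (simp add: remainder_def integrator_def f_inv_def X_def[symmetric]
        Z_def[symmetric] x_def Q_def)
  ultimately have "remainder n \<epsilon> (of_word w) = (1 + (1 - \<epsilon>) / (1 + \<epsilon>)) *\<^sub>R F w"
    by (simp add: scaleR_left_distrib)
  moreover have "1 + (1 - \<epsilon>) / (1 + \<epsilon>) = 2 / (1 + \<epsilon>)"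
    using assms(1) by (simp add: field_simps)
  ultimately have "remainder n \<epsilon> (of_word w)
      = (2 / (1 + \<epsilon>) * (1 / 2)) *\<^sub>R (of_word w - \<epsilon> *\<^sub>R wanti w)"
    by (simp only: F_def scaleR_scaleR)
  moreover have "2 / (1 + \<epsilon>) * (1 / 2) = 1 / (1 + \<epsilon>)"
    by (simp add: divide_simps)
  ultimately show ?thesis by (simp only:)
qed

text \<open>Words of other lengths are projected to 0 before the remainder is applied, so this value
  removes them from the inner product.\<close>

lemma remainder_0: "remainder n \<epsilon> 0 = 0"
  by (simp add: remainder_def integrator_def f_inv_def conv_sqrt_def Let_def
      linear_0[OF linear_proj] linear_0[OF linear_f_star_id] linear_0[OF linear_lin_ext])

section \<open>Reversal\<close>

definition rev_alg :: "('a list \<Rightarrow>\<^sub>0 real) \<Rightarrow> ('a list \<Rightarrow>\<^sub>0 real)" where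
  "rev_alg = lin_ext (\<lambda>w. of_word (rev w))"

definition right_deriv :: "'a \<Rightarrow> ('a list \<Rightarrow>\<^sub>0 real) \<Rightarrow> ('a list \<Rightarrow>\<^sub>0 real)" where
  "right_deriv a p = rev_alg (left_deriv a (rev_alg p))"

lemma linear_rev_alg: "linear rev_alg"
  by (simp add: rev_alg_def)

lemmas rev_alg_simps =
  linear_add[OF linear_rev_alg] linear_scale[OF linear_rev_alg] linear_0[OF linear_rev_alg]

lemma rev_alg_of_word [simp]: "rev_alg (of_word w) = of_word (rev w)"
  by (simp add: rev_alg_def)

lemma lookup_rev_alg: "Poly_Mapping.lookup (rev_alg p) w = Poly_Mapping.lookup p (rev w)"
  by (rule linear_eqI[where p = p, OF linear_compose[OF linear_rev_alg lookup_linear, unfolded o_def]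
        lookup_linear]) (auto simp: lookup_of_word)

lemma linear_right_deriv: "linear (right_deriv a)"
  unfolding right_deriv_def[abs_def]
  by (rule linearI) (simp_all add: rev_alg_simps left_deriv_simps)

lemmas right_deriv_simps =
  linear_add[OF linear_right_deriv] linear_scale[OF linear_right_deriv]
  linear_0[OF linear_right_deriv]

lemma lookup_right_deriv:
  "Poly_Mapping.lookup (right_deriv a p) w = Poly_Mapping.lookup p (w @ [a])"
  by (simp add: right_deriv_def lookup_rev_alg lookup_left_deriv)

lemma left_right_deriv: "left_deriv a (right_deriv c p) = right_deriv c (left_deriv a p)"
  by (rule poly_mapping_eqI) (simp add: lookup_left_deriv lookup_right_deriv)

lemma left_deriv_rev_alg: "left_deriv a (rev_alg p) = rev_alg (right_deriv a p)"
  by (rule poly_mapping_eqI) (simp add: lookup_left_deriv lookup_right_deriv lookup_rev_alg)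

lemma right_deriv_of_word:
  "right_deriv a (of_word w) = (if w \<noteq> [] \<and> last w = a then of_word (butlast w) else 0)"
  by (cases w rule: rev_cases) (auto simp: right_deriv_def rev_alg_simps)

text \<open>\<open>shuffle_list\<close> branches on first letters, so the Leibniz rule for last
  letters is not immediate; it follows by induction because left and right derivations
  commute.\<close>

lemma right_deriv_shuffle_words:
  "right_deriv c (shuffle (of_word u) (of_word v)) =
     shuffle (right_deriv c (of_word u)) (of_word v) + shuffle (of_word u) (right_deriv c (of_word v))"
proof (induction "length u + length v" arbitrary: u v rule: less_induct)
  case less
  show ?case
  proof (rule walg_eqI)
    \<comment> \<open>On one-letter words first and last letter coincide, so the left Leibniz rule
      settles the constant coefficient.\<close>
    have *: "Poly_Mapping.lookup p [c] = Poly_Mapping.lookup (left_deriv c p) []"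
      for p :: "'a list \<Rightarrow>\<^sub>0 real" by (simp add: lookup_left_deriv)
    show "Poly_Mapping.lookup (right_deriv c (shuffle (of_word u) (of_word v))) [] =
        Poly_Mapping.lookup (shuffle (right_deriv c (of_word u)) (of_word v)
          + shuffle (of_word u) (right_deriv c (of_word v))) []"
      by (simp add: lookup_right_deriv lookup_add lookup_Nil_shuffle * left_deriv_shuffle)
  next
    fix a
    have "right_deriv c (shuffle (left_deriv a (of_word u)) (of_word v)) =
        shuffle (right_deriv c (left_deriv a (of_word u))) (of_word v)
        + shuffle (left_deriv a (of_word u)) (right_deriv c (of_word v))"
      using less by (cases u) (auto simp: shuffle_simps right_deriv_simps)
    moreover have "right_deriv c (shuffle (of_word u) (left_deriv a (of_word v))) =
        shuffle (right_deriv c (of_word u)) (left_deriv a (of_word v))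
        + shuffle (of_word u) (right_deriv c (left_deriv a (of_word v)))"
      using less by (cases v) (auto simp: shuffle_simps right_deriv_simps)
    ultimately show "left_deriv a (right_deriv c (shuffle (of_word u) (of_word v))) =
        left_deriv a (shuffle (right_deriv c (of_word u)) (of_word v)
          + shuffle (of_word u) (right_deriv c (of_word v)))"
      by (simp add: left_right_deriv left_deriv_shuffle left_deriv_simps right_deriv_simps)
  qed
qed

text \<open>Reversal exchanges left and right derivations, and both obey the Leibniz rule.\<close>

lemma rev_alg_shuffle_words:
  "rev_alg (shuffle (of_word u) (of_word v)) = shuffle (of_word (rev u)) (of_word (rev v))"
proof (induction "length u + length v" arbitrary: u v rule: less_induct)
  case less
  show ?case
  proof (rule walg_eqI)
    fix a
    have "rev_alg (shuffle (right_deriv a (of_word u)) (of_word v)) =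
        shuffle (rev_alg (right_deriv a (of_word u))) (rev_alg (of_word v))"
      using less by (auto simp: right_deriv_of_word shuffle_simps rev_alg_simps)
    moreover have "rev_alg (shuffle (of_word u) (right_deriv a (of_word v))) =
        shuffle (rev_alg (of_word u)) (rev_alg (right_deriv a (of_word v)))"
      using less by (auto simp: right_deriv_of_word shuffle_simps rev_alg_simps)
    ultimately show "left_deriv a (rev_alg (shuffle (of_word u) (of_word v))) =
        left_deriv a (shuffle (of_word (rev u)) (of_word (rev v)))"
      by (simp add: left_deriv_rev_alg right_deriv_shuffle_words rev_alg_simps left_deriv_shuffle
          flip: rev_alg_of_word)
  qed (simp add: lookup_rev_alg lookup_Nil_shuffle lookup_of_word)
qed

text \<open>Every block is a palindrome.\<close>

lemma rev_dwords: "w \<in> dwords \<Longrightarrow> rev w \<in> dwords"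
proof -
  assume "w \<in> dwords"
  then obtain bs where "w = concat bs" "set bs \<subseteq> blocks" by (auto simp: dwords_def)
  moreover have "rev b = b" if "b \<in> blocks" for b :: "'a word"
    using that by (auto simp: blocks_def)
  ultimately have "rev w = concat (rev bs)"
    by (auto simp: rev_concat intro!: arg_cong[where f = concat] map_idI)
  then show ?thesis
    using \<open>set bs \<subseteq> blocks\<close> unfolding dwords_def by (auto intro!: exI[of _ "rev bs"])
qed

lemma rev_dwords_iff: "rev w \<in> dwords \<longleftrightarrow> w \<in> dwords"
  using rev_dwords[of w] rev_dwords[of "rev w"] by auto

lemma expect_rev_alg: "expect t (rev_alg p) = expect t p"
  by (rule linear_eqI[where p = p, OF linear_compose[OF linear_rev_alg linear_expect, unfolded o_def]
        linear_expect])
    (simp add: expect_of_word rev_dwords_iff num_block_def num_pair_def num_zero_def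
      rev_filter[symmetric])

lemma expect_wanti: "expect t (wanti w) = (- 1) ^ length w * expect t (of_word w)"
  using expect_rev_alg[of t "of_word w"] by (simp add: wanti_def expect_simps)

lemma expect_shuffle_wanti:
  "expect t (shuffle (wanti u) (wanti v))
     = (- 1) ^ (length u + length v) * expect t (shuffle (of_word u) (of_word v))"
  using expect_rev_alg[of t "shuffle (of_word u) (of_word v)"]
  by (simp add: wanti_def shuffle_simps expect_simps rev_alg_shuffle_words power_add)


section \<open>Positive semidefinite forms\<close>

definition psd_on :: "'i set \<Rightarrow> ('i \<Rightarrow> 'i \<Rightarrow> real) \<Rightarrow> bool" where
  "psd_on W M \<longleftrightarrow> (\<forall>u\<in>W. \<forall>v\<in>W. M u v = M v u) \<and>
     (\<forall>x. 0 \<le> (\<Sum>u\<in>W. \<Sum>v\<in>W. x u * x v * M u v))"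

lemma psd_on_nonneg: "psd_on W M \<Longrightarrow> 0 \<le> (\<Sum>u\<in>W. \<Sum>v\<in>W. x u * x v * M u v)"
  by (simp add: psd_on_def)

lemma quadratic_update:
  fixes M :: "'i \<Rightarrow> 'i \<Rightarrow> real" and x :: "'i \<Rightarrow> real" and c :: real
  assumes "finite W" "w \<in> W" "\<And>u v. u \<in> W \<Longrightarrow> v \<in> W \<Longrightarrow> M u v = M v u"
  defines "y \<equiv> \<lambda>u. x u - (if u = w then c else 0)"
  shows "(\<Sum>u\<in>W. \<Sum>v\<in>W. y u * y v * M u v) =
    (\<Sum>u\<in>W. \<Sum>v\<in>W. x u * x v * M u v) - 2 * c * (\<Sum>u\<in>W. x u * M u w) + c\<^sup>2 * M w w"
proof -
  let ?e = "\<lambda>u. if u = w then c else 0"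
  have "(\<Sum>u\<in>W. \<Sum>v\<in>W. y u * y v * M u v) =
      (\<Sum>u\<in>W. \<Sum>v\<in>W. x u * x v * M u v) - (\<Sum>u\<in>W. \<Sum>v\<in>W. x u * M u v * ?e v)
      - (\<Sum>u\<in>W. \<Sum>v\<in>W. ?e u * (x v * M u v)) + (\<Sum>u\<in>W. \<Sum>v\<in>W. ?e u * (M u v * ?e v))"
    unfolding y_def by (simp add: algebra_simps sum.distrib sum_subtractf)
  also have "(\<Sum>u\<in>W. \<Sum>v\<in>W. x u * M u v * ?e v) = c * (\<Sum>u\<in>W. x u * M u w)"
    using assms(1,2) by (simp add: if_distrib sum_distrib_left mult_ac cong: if_cong)
  also have "(\<Sum>u\<in>W. \<Sum>v\<in>W. ?e u * (x v * M u v)) = (\<Sum>u\<in>W. ?e u * (\<Sum>v\<in>W. x v * M u v))"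
    by (simp add: sum_distrib_left)
  also have "\<dots> = c * (\<Sum>v\<in>W. x v * M w v)"
    using assms(1,2) by (simp add: if_distrib[of "\<lambda>x. x * _"] cong: if_cong)
  also have "(\<Sum>v\<in>W. x v * M w v) = (\<Sum>v\<in>W. x v * M v w)"
    by (rule sum.cong) (use assms(2,3) in auto)
  also have "(\<Sum>u\<in>W. \<Sum>v\<in>W. ?e u * (M u v * ?e v)) = (\<Sum>u\<in>W. ?e u * (M u w * c))"
    using assms(1,2) by (intro sum.cong refl)
      (simp add: if_distrib[of "\<lambda>x. _ * x"] flip: sum_distrib_left cong: if_cong)
  also have "\<dots> = c\<^sup>2 * M w w"
    using assms(1,2) by (simp add: if_distrib[of "\<lambda>x. x * _"] power2_eq_square cong: if_cong)
  finally show ?thesis by simp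
qed

lemma psd_on_diag: "psd_on W M \<Longrightarrow> finite W \<Longrightarrow> w \<in> W \<Longrightarrow> 0 \<le> M w w"
proof -
  assume *: "psd_on W M" "finite W" "w \<in> W"
  have "0 \<le> (\<Sum>u\<in>W. \<Sum>v\<in>W. (0 - (if u = w then 1 else 0)) * (0 - (if v = w then 1 else 0)) * M u v)"
    by (rule psd_on_nonneg[OF *(1)])
  also have "\<dots> = M w w"
    using * by (subst quadratic_update) (auto simp: psd_on_def)
  finally show ?thesis .
qed

lemma psd_on_null:
  assumes "psd_on W M" "finite W" "w \<in> W" "M w w = 0" "u \<in> W"
  shows "M u w = 0"
proof (rule ccontr)
  assume b: "M u w \<noteq> 0"
  \<comment> \<open>Chosen so that the form at e_u - c e_w takes the value -1.\<close>
  define c where "c = (M u u + 1) / (2 * M u w)"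
  let ?x = "\<lambda>v. if v = u then 1 else (0 :: real)"
  have "0 \<le> (\<Sum>v\<in>W. \<Sum>v'\<in>W. (?x v - (if v = w then c else 0)) * (?x v' - (if v' = w then c else 0)) * M v v')"
    by (rule psd_on_nonneg[OF assms(1)])
  also have "\<dots> = (\<Sum>v\<in>W. \<Sum>v'\<in>W. ?x v * ?x v' * M v v') - 2 * c * (\<Sum>v\<in>W. ?x v * M v w) + c\<^sup>2 * M w w"
    by (rule quadratic_update) (use assms in \<open>auto simp: psd_on_def\<close>)
  also have "(\<Sum>v\<in>W. \<Sum>v'\<in>W. ?x v * ?x v' * M v v') = (\<Sum>v\<in>W. ?x v * (\<Sum>v'\<in>W. ?x v' * M v v'))"
    by (simp only: sum_distrib_left mult.assoc)
  also have "\<dots> - 2 * c * (\<Sum>v\<in>W. ?x v * M v w) + c\<^sup>2 * M w w = M u u - 2 * c * M u w"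
    using assms by (simp add: if_distrib[of "\<lambda>x. x * _"] cong: if_cong)
  also have "\<dots> < 0" using b by (simp add: c_def)
  finally show False by simp
qed

text \<open>If \<open>M w w = 0\<close>, the quotient is \<open>0\<close> and \<open>M\<close> is its own Schur complement.\<close>

definition schur_compl :: "'i \<Rightarrow> ('i \<Rightarrow> 'i \<Rightarrow> real) \<Rightarrow> 'i \<Rightarrow> 'i \<Rightarrow> real" where
  "schur_compl w M u v = M u v - M u w * M v w / M w w"

text \<open>Completing the square: its value at \<open>x\<close> is the value of \<open>M\<close> at
  x - c e_w with the c defined below, which minimises that value when \<open>M w w\<close> is
  positive and is 0 when \<open>M w w\<close> is 0.\<close>

lemma psd_on_schur_compl:
  assumes M: "psd_on W M" and W: "finite W" "w \<in> W"
  shows "psd_on W (schur_compl w M)"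
  unfolding psd_on_def
proof (intro conjI allI ballI)
  fix x
  let ?q = "\<Sum>u\<in>W. \<Sum>v\<in>W. x u * x v * M u v" and ?b = "\<Sum>u\<in>W. x u * M u w"
  define c where "c = ?b / M w w"
  have "(\<Sum>u\<in>W. \<Sum>v\<in>W. x u * x v * schur_compl w M u v)
      = ?q - (\<Sum>u\<in>W. \<Sum>v\<in>W. (x u * M u w) * (x v * M v w)) / M w w"
    by (simp add: schur_compl_def algebra_simps sum_subtractf sum_divide_distrib)
  also have "\<dots> = ?q - ?b * ?b / M w w"
    by (simp only: sum_product)
  also have "\<dots> = ?q - 2 * c * ?b + c\<^sup>2 * M w w"
    by (simp add: c_def power2_eq_square)
  also have "\<dots> = (\<Sum>u\<in>W. \<Sum>v\<in>W. (x u - (if u = w then c else 0)) * (x v - (if v = w then c else 0)) * M u v)"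
    by (rule quadratic_update[symmetric]) (use M W in \<open>auto simp: psd_on_def\<close>)
  also have "\<dots> \<ge> 0"
    by (rule psd_on_nonneg[OF M])
  finally show "0 \<le> (\<Sum>u\<in>W. \<Sum>v\<in>W. x u * x v * schur_compl w M u v)" .
qed (use M in \<open>auto simp: schur_compl_def psd_on_def mult.commute\<close>)

lemma schur_compl_pivot:
  assumes "psd_on W M" "finite W" "w \<in> W" "u \<in> W"
  shows "schur_compl w M u w = 0" "schur_compl w M w u = 0"
  using psd_on_null[OF assms(1-3) _ assms(4)] assms
  by (cases "M w w = 0"; auto simp: schur_compl_def psd_on_def)+

lemma psd_on_subset:
  assumes "psd_on W M" "finite W" "U \<subseteq> W"
  shows "psd_on U M"
  unfolding psd_on_def
proof (intro conjI allI)
  fix x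
  have "0 \<le> (\<Sum>u\<in>W. \<Sum>v\<in>W. (if u \<in> U then x u else 0) * (if v \<in> U then x v else 0) * M u v)"
    by (rule psd_on_nonneg[OF assms(1)])
  also have "\<dots> = (\<Sum>u\<in>U. \<Sum>v\<in>W. (if u \<in> U then x u else 0) * (if v \<in> U then x v else 0) * M u v)"
    by (rule sum.mono_neutral_right) (use assms in auto)
  also have "\<dots> = (\<Sum>u\<in>U. \<Sum>v\<in>U. (if u \<in> U then x u else 0) * (if v \<in> U then x v else 0) * M u v)"
    by (intro sum.cong refl sum.mono_neutral_right) (use assms in auto)
  finally show "0 \<le> (\<Sum>u\<in>U. \<Sum>v\<in>U. x u * x v * M u v)" by simp
qed (use assms in \<open>auto simp: psd_on_def\<close>)

section \<open>Entrywise pairing of two semidefinite forms\<close>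

lemma trace_schur_split:
  "(\<Sum>u\<in>W. \<Sum>v\<in>W. M u v * V u v) = (\<Sum>u\<in>W. \<Sum>v\<in>W. schur_compl w M u v * V u v)
     + (\<Sum>u\<in>W. \<Sum>v\<in>W. M u w * M v w * V u v) / M w w"
  by (simp add: schur_compl_def algebra_simps sum_subtractf sum_divide_distrib)

text \<open>Symmetric elimination as in a Cholesky factorisation: each pivot splits off a rank-one
  matrix, whose pairing with \<open>V\<close> is a value of the form of \<open>V\<close>, and the
  Schur complement lives on the remaining indices.\<close>

lemma trace_nonneg:
  assumes "finite W" "psd_on W M" "psd_on W V"
  shows "0 \<le> (\<Sum>u\<in>W. \<Sum>v\<in>W. M u v * V u v)"
  using assms
proof (induction W arbitrary: M)
  case (insert w W)
  let ?M = "schur_compl w M"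
  have fin: "finite (insert w W)" using insert by simp
  note piv = schur_compl_pivot[OF insert.prems(1) fin insertI1]
  have "0 \<le> (\<Sum>u\<in>W. \<Sum>v\<in>W. ?M u v * V u v)"
    using psd_on_schur_compl[OF insert.prems(1) fin insertI1] insert.prems(2)
    by (intro insert.IH) (auto intro: psd_on_subset[OF _ fin])
  also have "\<dots> = (\<Sum>u\<in>insert w W. \<Sum>v\<in>insert w W. ?M u v * V u v)"
    using insert.hyps piv by simp
  also have "\<dots> \<le> (\<Sum>u\<in>insert w W. \<Sum>v\<in>insert w W. M u v * V u v)"
    unfolding trace_schur_split[of M V _ w]
    using insert.prems(2) psd_on_diag[OF insert.prems(1) fin insertI1]
    by (simp only: le_add_same_cancel1) (intro divide_nonneg_nonneg psd_on_nonneg)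
  finally show ?case .
qed simp

text \<open>One pivot suffices: the column of \<open>M\<close> at \<open>w\<close> is nonzero at
  \<open>w\<close>, so the definite form of \<open>V\<close> is positive on it.\<close>

lemma trace_pos:
  assumes "finite W" "psd_on W M" "psd_on W V"
    and pd: "\<And>x. x w \<noteq> 0 \<Longrightarrow> 0 < (\<Sum>u\<in>W. \<Sum>v\<in>W. x u * x v * V u v)"
    and w: "w \<in> W" "0 < M w w"
  shows "0 < (\<Sum>u\<in>W. \<Sum>v\<in>W. M u v * V u v)"
  unfolding trace_schur_split[of M V _ w]
proof (rule add_nonneg_pos)
  show "0 \<le> (\<Sum>u\<in>W. \<Sum>v\<in>W. schur_compl w M u v * V u v)"
    using assms by (intro trace_nonneg psd_on_schur_compl)
  show "0 < (\<Sum>u\<in>W. \<Sum>v\<in>W. M u w * M v w * V u v) / M w w"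
    using pd[of "\<lambda>u. M u w"] w by simp
qed

lemma sym_pos_def_sum_pos:
  assumes V: "sym_pos_def V" and W: "finite W" "w \<in> W" and x: "x w \<noteq> (0 :: real)"
  shows "0 < (\<Sum>u\<in>W. \<Sum>v\<in>W. x u * x v * V u v)"
proof -
  define p where "p = (\<Sum>u\<in>W. Poly_Mapping.single u (x u))"
  have lookup: "Poly_Mapping.lookup p u = (if u \<in> W then x u else 0)" for u
    using W(1) by (simp add: p_def lookup_sum lookup_single when_def)
  have "p \<noteq> 0" using lookup[of w] W x by auto
  then have "0 < (\<Sum>u\<in>Poly_Mapping.keys p. \<Sum>v\<in>Poly_Mapping.keys p.
      Poly_Mapping.lookup p u * Poly_Mapping.lookup p v * V u v)"
    using V by (simp add: sym_pos_def_def)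
  also have "\<dots> = (\<Sum>u\<in>Poly_Mapping.keys p. \<Sum>v\<in>W.
      Poly_Mapping.lookup p u * Poly_Mapping.lookup p v * V u v)"
    by (intro sum.cong refl sum.mono_neutral_left)
      (use W(1) in \<open>auto simp: in_keys_iff lookup split: if_splits\<close>)
  also have "\<dots> = (\<Sum>u\<in>W. \<Sum>v\<in>W. Poly_Mapping.lookup p u * Poly_Mapping.lookup p v * V u v)"
    by (intro sum.mono_neutral_left)
      (use W(1) in \<open>auto simp: in_keys_iff lookup split: if_splits\<close>)
  finally show ?thesis by (simp add: lookup)
qed

lemma sym_pos_def_psd_on:
  assumes "sym_pos_def V" "finite W"
  shows "psd_on W V"
  unfolding psd_on_def
proof (intro conjI allI)
  fix x :: "'a \<Rightarrow> real"
  show "0 \<le> (\<Sum>u\<in>W. \<Sum>v\<in>W. x u * x v * V u v)"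
  proof (cases "\<exists>w\<in>W. x w \<noteq> 0")
    case True
    then show ?thesis
      using sym_pos_def_sum_pos[OF assms, of _ x] by (meson less_imp_le)
  qed simp
qed (use assms(1) in \<open>auto simp: sym_pos_def_def\<close>)


section \<open>The covariance form\<close>

definition cov :: "real \<Rightarrow> ('d::finite) walg \<Rightarrow> 'd walg \<Rightarrow> real" where
  "cov t p q = expect t (shuffle p q) - expect t p * expect t q"

lemma cov_commute: "cov t p q = cov t q p"
  by (simp add: cov_def shuffle_commute[of p q] mult.commute)

lemma linear_cov: "linear (cov t p)"
  by (rule linearI) (simp_all add: cov_def shuffle_simps expect_simps algebra_simps)

lemma linear_cov_left: "linear (\<lambda>p. cov t p q)"
  using linear_cov[of t q] by (simp add: cov_commute[of t _ q])

lemmas cov_simps =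
  linear_add[OF linear_cov] linear_diff[OF linear_cov] linear_scale[OF linear_cov]
  linear_sum[OF linear_cov]
  linear_add[OF linear_cov_left] linear_diff[OF linear_cov_left] linear_scale[OF linear_cov_left]
  linear_sum[OF linear_cov_left]

lemma cov_nonneg: "0 \<le> t \<Longrightarrow> 0 \<le> cov t p p"
  using deg_le_exists[of p] expect_square_ge[of _ p t]
  by (auto simp: cov_def power2_eq_square)

lemma psd_on_cov:
  assumes "0 \<le> t"
  shows "psd_on W (\<lambda>u v. cov t (X u) (X v))"
  unfolding psd_on_def
proof (intro conjI allI)
  fix x
  have "(\<Sum>u\<in>W. \<Sum>v\<in>W. x u * x v * cov t (X u) (X v))
      = (\<Sum>u\<in>W. x u * cov t (X u) (\<Sum>v\<in>W. x v *\<^sub>R X v))"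
    by (simp add: cov_simps sum_distrib_left mult.assoc)
  also have "\<dots> = cov t (\<Sum>u\<in>W. x u *\<^sub>R X u) (\<Sum>v\<in>W. x v *\<^sub>R X v)"
    by (simp add: cov_simps(5-8))
  finally show "0 \<le> (\<Sum>u\<in>W. \<Sum>v\<in>W. x u * x v * cov t (X u) (X v))"
    using cov_nonneg[OF assms] by simp
qed (auto intro: cov_commute)

text \<open>For equal lengths the two signs multiply to 1, and the expectation is invariant under
  reversal.\<close>

lemma cov_wanti:
  assumes "length u = length v"
  shows "cov t (wanti u) (wanti v) = cov t (of_word u) (of_word v)"
  using assms by (simp add: cov_def expect_shuffle_wanti expect_wanti power_add[symmetric])

lemma expect_endo_eq: "expect_endo t p = expect t p *\<^sub>R of_word []"
  unfolding expect_endo_def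
  by (rule linear_eqI[where p = p]; (rule linearI)?)
    (simp_all add: linear_add[OF linear_lin_ext] linear_scale[OF linear_lin_ext] expect_simps
      scaleR_add_left)

lemma expect_centred_shuffle:
  "expect t (shuffle (id_minus_E t p) (id_minus_E t q)) = cov t p q"
  by (simp add: id_minus_E_def expect_endo_eq cov_def shuffle_simps expect_simps algebra_simps)

lemma finite_words: "finite {w :: ('d::finite) word. length w = m}"
  using finite_lists_length_eq[of "UNIV :: 'd option set" m] by simp

lemma graded_inner_eq:
  fixes V :: "('d::finite) word \<Rightarrow> 'd word \<Rightarrow> real"
  assumes "X 0 = 0"
  shows "graded_inner t V {m} (id_minus_E t \<circ> X) (id_minus_E t \<circ> X) =
    (\<Sum>u\<in>{w. length w = m}. \<Sum>v\<in>{w. length w = m}.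
       cov t (X (of_word u)) (X (of_word v)) * V u v)"
proof -
  let ?W = "{w :: 'd word. length w = m}"
  let ?Y = "(id_minus_E t \<circ> X) \<circ> proj {m}"
  have Y: "?Y (of_word u) = (if u \<in> ?W then id_minus_E t (X (of_word u)) else 0)" for u
    using assms by (simp add: proj_of_word id_minus_E_def expect_endo_eq expect_simps)
  have "graded_inner t V {m} (id_minus_E t \<circ> X) (id_minus_E t \<circ> X) =
      (\<Sum>\<^sub>\<infinity>(u, v)\<in>?W \<times> ?W. cov t (X (of_word u)) (X (of_word v)) * V u v)"
    unfolding graded_inner_def inner_endo_def
    by (rule infsum_cong_neutral)
      (auto simp: Y expect_centred_shuffle shuffle_simps expect_simps simp del: o_apply
        split: if_splits)
  also have "\<dots> = (\<Sum>(u, v)\<in>?W \<times> ?W. cov t (X (of_word u)) (X (of_word v)) * V u v)"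
    by (rule infsum_finite) (simp add: finite_words)
  finally show ?thesis by (simp add: sum.cartesian_product)
qed

text \<open>Undoing the square root of the norm requires the inner product to be nonnegative, hence
  the hypotheses on \<open>t\<close> and \<open>V\<close>.\<close>

lemma graded_norm_square_eq:
  fixes V :: "('d::finite) word \<Rightarrow> 'd word \<Rightarrow> real"
  assumes "X 0 = 0" "0 \<le> t" "sym_pos_def V"
  shows "(graded_norm t V {m} (id_minus_E t \<circ> X))\<^sup>2 =
    (\<Sum>u\<in>{w. length w = m}. \<Sum>v\<in>{w. length w = m}.
       cov t (X (of_word u)) (X (of_word v)) * V u v)"
  unfolding graded_norm_def graded_inner_eq[of X, OF assms(1)]
  by (intro real_sqrt_pow2 trace_nonneg finite_words psd_on_cov sym_pos_def_psd_on assms)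

text \<open>
  On words of length \<open>n + 1\<close> the remainder is \<open>(id - \<epsilon> S) / (1 + \<epsilon>)\<close>, and \<open>S\<close> is an isometry there.
  Hence, with \<open>A\<close> the squared norm of \<open>id - E\<close> and \<open>B\<close> its inner product with \<open>(id - E) S\<close>, the excess is
  \<open>A - ((1 + \<epsilon>\<^sup>2) A - 2 \<epsilon> B) / (1 + \<epsilon>)\<^sup>2\<close>.
\<close>

lemma ms_excess_formula:
  fixes V :: "('d::finite) word \<Rightarrow> 'd word \<Rightarrow> real"
  assumes t: "t > 0" and n: "n \<ge> 1" and V: "sym_pos_def V"
  obtains K where "K > 0" "\<And>\<epsilon>. \<epsilon> > 0 \<Longrightarrow> ms_excess t V n \<epsilon> = K * (\<epsilon> / (1 + \<epsilon>)\<^sup>2)"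
proof
  let ?W = "{w :: 'd word. length w = n + 1}"
  define T where "T = (\<lambda>M. \<Sum>u\<in>?W. \<Sum>v\<in>?W. M u v * V u v)"
  define A where "A = T (\<lambda>u v. cov t (of_word u) (of_word v))"
  define B where "B = T (\<lambda>u v. cov t (of_word u) (wanti v))"
  have T_linear: "T (\<lambda>u v. M u v + N u v) = T M + T N" "T (\<lambda>u v. c * M u v) = c * T M" for M N c
    by (simp_all add: T_def sum.distrib sum_distrib_left algebra_simps)
  have T_cong: "T M = T N" if "\<And>u v. u \<in> ?W \<Longrightarrow> v \<in> ?W \<Longrightarrow> M u v = N u v" for M N
    unfolding T_def by (intro sum.cong refl arg_cong2[where f = times] that)
  have B': "T (\<lambda>u v. cov t (wanti u) (of_word v)) = B"
    unfolding B_def T_def using V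
    by (subst sum.swap) (simp add: cov_commute[of t "wanti _"] sym_pos_def_def)
  \<comment> \<open>Used twice: k = c = 1 gives the squared norm 2 (A + B) of id + S, and k = 1/(1 +
    \<epsilon>), c = -\<epsilon> gives that of the remainder.\<close>
  have quad: "T (\<lambda>u v. cov t (k *\<^sub>R (of_word u + c *\<^sub>R wanti u)) (k *\<^sub>R (of_word v + c *\<^sub>R wanti v)))
      = k\<^sup>2 * ((1 + c\<^sup>2) * A + 2 * c * B)" for k c
  proof -
    have "T (\<lambda>u v. cov t (k *\<^sub>R (of_word u + c *\<^sub>R wanti u)) (k *\<^sub>R (of_word v + c *\<^sub>R wanti v)))
      = T (\<lambda>u v. (k\<^sup>2 * (1 + c\<^sup>2)) * cov t (of_word u) (of_word v)
          + ((k\<^sup>2 * c) * cov t (of_word u) (wanti v) + (k\<^sup>2 * c) * cov t (wanti u) (of_word v)))"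
      by (rule T_cong) (simp add: cov_simps cov_wanti algebra_simps power2_eq_square)
    also have "\<dots> = k\<^sup>2 * ((1 + c\<^sup>2) * A + 2 * c * B)"
      unfolding T_linear B' A_def[symmetric] B_def[symmetric] by (simp add: algebra_simps)
    finally show ?thesis .
  qed
  let ?M = "\<lambda>u v. cov t (1 *\<^sub>R (of_word u + 1 *\<^sub>R wanti u)) (1 *\<^sub>R (of_word v + 1 *\<^sub>R wanti v))"
  \<comment> \<open>The letter is an arbitrary Wiener letter. With no zeros the word would be a
    single letter, on which id + S vanishes; this is where \<open>n\<close> \<ge> 1 enters.\<close>
  let ?w = "replicate n None @ [Some undefined] :: 'd word"
  have "1 *\<^sub>R (of_word ?w + 1 *\<^sub>R wanti ?w) = of_word (replicate n None @ [Some undefined])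
      + (- 1) ^ (n + 1) *\<^sub>R of_word (Some undefined # replicate n None)"
    by (simp add: wanti_def)
  moreover have "\<bar>(- 1) ^ (n + 1) :: real\<bar> = 1"
    by (simp add: power_abs)
  ultimately have "0 < ?M ?w ?w"
    using variance_zeros_pos[of n t "(- 1) ^ (n + 1)" undefined] t n
    unfolding cov_def power2_eq_square by (simp only:) simp
  moreover have "0 < (\<Sum>u\<in>?W. \<Sum>v\<in>?W. x u * x v * V u v)" if "x ?w \<noteq> 0" for x
    by (rule sym_pos_def_sum_pos[where w = ?w and x = x, OF V finite_words _ that]) simp
  moreover have "psd_on ?W ?M"
    by (rule psd_on_cov) (use t in simp)
  ultimately have "0 < T ?M"
    unfolding T_def using sym_pos_def_psd_on[OF V finite_words]
    by (intro trace_pos[where w = ?w and M = ?M, OF finite_words]) simp_all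
  then show "0 < 2 * (A + B)"
    unfolding quad by simp
  fix \<epsilon> :: real assume eps: "\<epsilon> > 0"
  have "(graded_norm t V {n + 1} (id_minus_E t \<circ> remainder n \<epsilon>))\<^sup>2
      = T (\<lambda>u v. cov t (remainder n \<epsilon> (of_word u)) (remainder n \<epsilon> (of_word v)))"
    using graded_norm_square_eq[of "remainder n \<epsilon>" t V "n + 1", OF remainder_0] t V
    by (simp add: T_def)
  also have "\<dots> = (1 / (1 + \<epsilon>))\<^sup>2 * ((1 + (- \<epsilon>)\<^sup>2) * A + 2 * (- \<epsilon>) * B)"
    unfolding quad[symmetric] by (rule T_cong) (simp add: remainder_of_word eps)
  finally have R: "(graded_norm t V {n + 1} (id_minus_E t \<circ> remainder n \<epsilon>))\<^sup>2
      = ((1 + \<epsilon>\<^sup>2) * A - 2 * \<epsilon> * B) / (1 + \<epsilon>)\<^sup>2"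
    by (simp add: power_divide)
  have I: "(graded_norm t V {n + 1} (id_minus_E t \<circ> id))\<^sup>2 = A"
    using graded_norm_square_eq[of id t V "n + 1"] t V by (simp add: A_def T_def)
  have "A = (1 + \<epsilon>)\<^sup>2 * A / (1 + \<epsilon>)\<^sup>2" using eps by simp
  then have "ms_excess t V n \<epsilon> = ((1 + \<epsilon>)\<^sup>2 * A - ((1 + \<epsilon>\<^sup>2) * A - 2 * \<epsilon> * B)) / (1 + \<epsilon>)\<^sup>2"
    unfolding ms_excess_def R I by (simp only: diff_divide_distrib)
  also have "(1 + \<epsilon>)\<^sup>2 * A - ((1 + \<epsilon>\<^sup>2) * A - 2 * \<epsilon> * B) = 2 * (A + B) * \<epsilon>"
    by (simp add: power2_eq_square algebra_simps)
  finally show "ms_excess t V n \<epsilon> = 2 * (A + B) * (\<epsilon> / (1 + \<epsilon>)\<^sup>2)" by simp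
qed

theorem theorem1:
  fixes t :: real
  assumes "t > 0"
  shows "(\<forall>\<epsilon>>0. \<forall>n\<ge>1. \<forall>V :: 'd::finite word \<Rightarrow> 'd word \<Rightarrow> real. sym_pos_def V \<longrightarrow>
            (graded_norm t V {n + 1} (id_minus_E t \<circ> remainder n \<epsilon>))\<^sup>2
              \<le> (graded_norm t V {n + 1} (id_minus_E t \<circ> id))\<^sup>2)
       \<and> (\<forall>n\<ge>1. \<forall>V :: 'd word \<Rightarrow> 'd word \<Rightarrow> real. sym_pos_def V \<longrightarrow>
            (\<forall>\<epsilon>>0. 0 < ms_excess t V n \<epsilon>) \<and>
            (\<forall>\<epsilon>>0. ms_excess t V n \<epsilon> \<le> ms_excess t V n 1))
       \<and> (f_star id 1 :: 'd endo) = (\<lambda>p. (1/2) *\<^sub>R (id p - antipode p))"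
proof -
  have excess: "0 < ms_excess t V n \<epsilon> \<and> ms_excess t V n \<epsilon> \<le> ms_excess t V n 1"
    if eps: "\<epsilon> > 0" and n: "n \<ge> 1" and V: "sym_pos_def V"
    for \<epsilon> n and V :: "'d word \<Rightarrow> 'd word \<Rightarrow> real"
  proof -
    obtain K where K: "K > 0" "\<And>\<epsilon>. \<epsilon> > 0 \<Longrightarrow> ms_excess t V n \<epsilon> = K * (\<epsilon> / (1 + \<epsilon>)\<^sup>2)"
      using ms_excess_formula[OF assms n V] by blast
    \<comment> \<open>Equality holds exactly at \<epsilon> = 1, which singles out the sinhlog
      endomorphism.\<close>
    have "4 * \<epsilon> \<le> (1 + \<epsilon>)\<^sup>2"
      using zero_le_power2[of "1 - \<epsilon>"] by (simp add: power2_eq_square algebra_simps)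
    then have "\<epsilon> / (1 + \<epsilon>)\<^sup>2 \<le> 1 / (1 + 1)\<^sup>2"
      using eps by (simp add: divide_le_eq)
    then have "K * (\<epsilon> / (1 + \<epsilon>)\<^sup>2) \<le> K * (1 / (1 + 1)\<^sup>2)"
      using K(1) by (intro mult_left_mono) simp_all
    moreover have "0 < K * (\<epsilon> / (1 + \<epsilon>)\<^sup>2)"
      using K(1) eps by simp
    ultimately show ?thesis
      unfolding K(2)[OF eps] K(2)[OF zero_less_one] by blast
  qed
  then have "(graded_norm t V {n + 1} (id_minus_E t \<circ> remainder n \<epsilon>))\<^sup>2
      \<le> (graded_norm t V {n + 1} (id_minus_E t \<circ> id))\<^sup>2"
    if "\<epsilon> > 0" "n \<ge> 1" "sym_pos_def V" for \<epsilon> n and V :: "'d word \<Rightarrow> 'd word \<Rightarrow> real"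
    using excess[OF that] unfolding ms_excess_def by simp
  moreover have "(f_star id 1 :: 'd endo) = (\<lambda>p. (1/2) *\<^sub>R (id p - antipode p))"
    by (simp add: f_star_id)
  ultimately show ?thesis using excess by blast
qed

end
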